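(* Let $\mathbb{k}$ be a field and let $I$ be a monomial ideal in a polynomial ring over $\mathbb{k}$ in finitely many variables. If $I$ is a polymatroidal ideal with the strong exchange property, a transversal polymatroidal ideal, or a Ferrers ideal, then the Rees ideal of $I$ is generated in degrees $(0,2)$ and $(1,1)$.
   Context: For a monomial ideal $I$, $\mathcal{G}(I)$ denotes its minimal generating set of monomials. Polymatroidal: all monomials in $\mathcal{G}(I)$ have the same degree, and whenever $x_1^{a_1}\cdots x_n^{a_n}$, $x_1^{b_1}\cdots x_n^{b_n}\in\mathcal{G}(I)$ with $a_i>b_i$ for some $i$, there is a $j$ with $a_j<b_j$ and $(x_j/x_i)x_1^{a_1}\cdots x_n^{a_n}\in\mathcal{G}(I)$. Strong exchange property (for a polymatroidal ideal $I$): whenever $x_1^{a_1}\cdots x_n^{a_n}$, $x_1^{b_1}\cdots x_n^{b_n}\in\mathcal{G}(I)$ with $a_i>b_i$ and $a_j<b_j$, then $(x_j/x_i)x_1^{a_1}\cdots x_n^{a_n}\in\mathcal{G}(I)$. Transversal: $I$ is a product of ideals each generated by a set of variables. Ferrers ideal: the edge ideal of a Ferrers graph. A Ferrers graph is a bipartite graph $G=(V,E)$ with vertex partition $V=\{x_1,\ldots,x_n\}\cup\{y_1,\ldots,y_m\}$ such that, after possibly re-indexing the vertices, writing $e_{ij}$ for the edge $\{x_i,y_j\}$: $e_{ij}\in E$ implies $e_{rs}\in E$ for all $1\le r\le i$ and $1\le s\le j$. Its edge ideal is the ideal of $\mathbb{k}[x_1,\ldots,x_n,y_1,\ldots,y_m]$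 generated by all $x_iy_j$ with $e_{ij}\in E$. Rees ideal: let $S$ be the ambient polynomial ring of $I$, and $\mathcal{G}(I)=\{f_1,\ldots,f_m\}$. Let $T=S[y_1,\ldots,y_m]$ (with $y_1,\dots,y_m$ new variables), bigraded by giving each variable of $S$ degree $(1,0)$ and each $y_i$ degree $(0,1)$, and let $\phi:T\to S[t]$ be the $S$-algebra homomorphism with $\phi(y_i)=f_it$. The Rees ideal of $I$ is $J=\ker\phi$, which is bihomogeneous when the $f_i$ all have the same degree. "Generated in degrees $(0,2)$ and $(1,1)$" means that $J$ is generated as an ideal of $T$ by its elements that are bihomogeneous of degree $(0,2)$ or $(1,1)$. *)

theory Defs
  imports "HOL-Library.Poly_Mapping" "HOL-Computational_Algebra.Polynomial"
begin

text \<open>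
  Exponent vectors over the variables \<^typ>\<open>'x\<close> are finitely supported functions, and
  the polynomial ring over \<^typ>\<open>'k\<close> is the monoid ring of the exponent vectors
  (with the convolution product of \<^theory>\<open>HOL-Library.Poly_Mapping\<close>).
\<close>

type_synonym 'x expo = "'x \<Rightarrow>\<^sub>0 nat"
type_synonym ('x, 'k) mpoly = "'x expo \<Rightarrow>\<^sub>0 'k"

definition monomial :: "'x expo \<Rightarrow> ('x, 'k::comm_ring_1) mpoly" where
  "monomial a = Poly_Mapping.single a 1"

definition var :: "'x \<Rightarrow> ('x, 'k::comm_ring_1) mpoly" where
  "var i = monomial (Poly_Mapping.single i 1)"

definition mdeg :: "'x expo \<Rightarrow> nat" where
  "mdeg a = (\<Sum>i\<in>Poly_Mapping.keys a. Poly_Mapping.lookup a i)"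


text \<open>Ideals of a commutative ring are the submodules of the ring over itself.\<close>

interpretation ideal: module "(*) :: 'a \<Rightarrow> 'a \<Rightarrow> 'a::comm_ring_1"
  by standard (simp_all add: algebra_simps)

definition ideal_mult :: "'a::comm_ring_1 set \<Rightarrow> 'a set \<Rightarrow> 'a set" where
  "ideal_mult I J = ideal.span {a * b |a b. a \<in> I \<and> b \<in> J}"

definition monomial_ideal :: "('x, 'k::field) mpoly set \<Rightarrow> bool" where
  "monomial_ideal I \<longleftrightarrow> (\<exists>M. I = ideal.span (monomial ` M))"

definition is_min_gens :: "('x, 'k::field) mpoly set \<Rightarrow> 'x expo set \<Rightarrow> bool" where
  "is_min_gens I M \<longleftrightarrow>
     ideal.span (monomial ` M) = I \<and> (\<forall>M'. M' \<subset> M \<longrightarrow> ideal.span (monomial ` M') \<noteq> I)"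

text \<open>The set of exponent vectors of the minimal monomial generators; that it is well defined
  for every monomial ideal is \<open>is_min_gens_min_gens\<close> below.\<close>

definition min_gens :: "('x, 'k::field) mpoly set \<Rightarrow> 'x expo set" where
  "min_gens I = (THE M. is_min_gens I M)"

lemma keys_in_monomial_span:
  fixes p :: "('x, 'k::field) mpoly"
  assumes "p \<in> ideal.span (monomial ` M)" "a \<in> Poly_Mapping.keys p"
  shows "\<exists>m\<in>M. \<exists>c. a = c + m"
  using assms
proof (induction arbitrary: a rule: ideal.span_induct_alt)
  case base
  then show ?case by simp
next
  case (step c x y)
  from step.hyps(1) obtain m where m: "m \<in> M" "x = monomial m" by auto
  from step.prems have "a \<in> Poly_Mapping.keys (c * x) \<or> a \<in> Poly_Mapping.keys y"
    using keys_add[of "c * x" y] by blast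
  then show ?case
  proof
    assume "a \<in> Poly_Mapping.keys (c * x)"
    with keys_mult[of c x] m have "\<exists>b. a = b + m"
      by (auto simp: monomial_def)
    with m(1) show ?thesis by blast
  next
    assume "a \<in> Poly_Mapping.keys y"
    with step.IH show ?thesis .
  qed
qed

lemma monomial_in_span_iff:
  "(monomial a :: ('x, 'k::field) mpoly) \<in> ideal.span (monomial ` M) \<longleftrightarrow> (\<exists>m\<in>M. \<exists>c. a = c + m)"
proof
  assume "(monomial a :: ('x, 'k) mpoly) \<in> ideal.span (monomial ` M)"
  then show "\<exists>m\<in>M. \<exists>c. a = c + m"
    by (rule keys_in_monomial_span) (simp add: monomial_def)
next
  assume "\<exists>m\<in>M. \<exists>c. a = c + m"
  then obtain m c where "m \<in> M" "a = c + m" by blast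
  moreover have "(monomial (c + m) :: ('x, 'k) mpoly) = monomial c * monomial m"
    by (simp add: monomial_def mult_single)
  ultimately show "(monomial a :: ('x, 'k) mpoly) \<in> ideal.span (monomial ` M)"
    by (simp add: ideal.span_base ideal.span_scale)
qed

lemma mdeg_sum: "finite A \<Longrightarrow> Poly_Mapping.keys a \<subseteq> A \<Longrightarrow> mdeg a = (\<Sum>i\<in>A. Poly_Mapping.lookup a i)"
  unfolding mdeg_def by (rule sum.mono_neutral_left) (auto simp: in_keys_iff)

lemma mdeg_plus: "mdeg (a + b) = mdeg a + mdeg b"
proof -
  let ?A = "Poly_Mapping.keys a \<union> Poly_Mapping.keys b"
  have "mdeg (a + b) = (\<Sum>i\<in>?A. Poly_Mapping.lookup (a + b) i)"
    by (rule mdeg_sum) (simp_all add: keys_add)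
  also have "\<dots> = mdeg a + mdeg b"
    by (simp add: lookup_add sum.distrib mdeg_sum[of ?A])
  finally show ?thesis .
qed

lemma mdeg_eq_0: "mdeg a = 0 \<longleftrightarrow> a = 0"
  unfolding mdeg_def by (auto simp: in_keys_iff intro: poly_mapping_eqI)

lemma is_min_gens_iff:
  fixes I :: "('x, 'k::field) mpoly set"
  assumes "monomial_ideal I"
  shows "is_min_gens I M \<longleftrightarrow>
    M = {a. monomial a \<in> I \<and> (\<forall>b c. monomial b \<in> I \<longrightarrow> a = c + b \<longrightarrow> b = a)}" (is "_ \<longleftrightarrow> M = ?G")
proof -
  from assms obtain N where N: "I = ideal.span (monomial ` N)"
    unfolding monomial_ideal_def by blast
  have below: "\<exists>b\<in>?G. \<exists>c. a = c + b" if "monomial a \<in> I" for a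
    using that
  proof (induction "mdeg a" arbitrary: a rule: less_induct)
    case less
    show ?case
    proof (cases "a \<in> ?G")
      case True
      then show ?thesis by (intro bexI[of _ a] exI[of _ 0]) simp_all
    next
      case False
      with less.prems obtain b c where b: "monomial b \<in> I" "a = c + b" "b \<noteq> a" by blast
      from b(2,3) have "c \<noteq> 0" by auto
      then have "mdeg b < mdeg a" using mdeg_eq_0[of c] by (simp add: b(2) mdeg_plus)
      from less.hyps[OF this b(1)] obtain d e where de: "d \<in> ?G" "b = e + d" by blast
      have "a = (c + e) + d" unfolding b(2) de(2) by (rule add.assoc[symmetric])
      with de(1) show ?thesis by blast
    qed
  qed
  have G_gen: "ideal.span (monomial ` ?G) = I"
  proof (rule antisym)
    show "ideal.span (monomial ` ?G) \<subseteq> I"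
      unfolding N by (rule ideal.span_minimal) auto
    have "(monomial ` N :: ('x, 'k) mpoly set) \<subseteq> ideal.span (monomial ` ?G)"
    proof
      fix p :: "('x, 'k) mpoly" assume "p \<in> monomial ` N"
      then obtain n where n: "n \<in> N" "p = monomial n" by blast
      then have "monomial n \<in> I" unfolding N by (auto intro: ideal.span_base)
      from below[OF this] show "p \<in> ideal.span (monomial ` ?G)"
        by (simp only: n(2) monomial_in_span_iff)
    qed
    then show "I \<subseteq> ideal.span (monomial ` ?G)"
      unfolding N by (rule ideal.span_minimal) auto
  qed
  have sub: "?G \<subseteq> M'" if "ideal.span (monomial ` M') = I" for M'
  proof
    fix a assume a: "a \<in> ?G"
    with that have "monomial a \<in> ideal.span (monomial ` M' :: ('x, 'k) mpoly set)" by simp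
    then obtain m c where m: "m \<in> M'" "a = c + m"
      using monomial_in_span_iff by blast
    then have "monomial m \<in> I" using that by (auto intro: ideal.span_base)
    with a m(2) have "m = a" by simp
    with m(1) show "a \<in> M'" by simp
  qed
  show ?thesis
  proof
    assume "is_min_gens I M"
    then show "M = ?G"
      using sub[of M] G_gen unfolding is_min_gens_def by blast
  next
    assume "M = ?G"
    then show "is_min_gens I M"
      using sub G_gen unfolding is_min_gens_def by blast
  qed
qed

lemma is_min_gens_min_gens:
  assumes "monomial_ideal I"
  shows "is_min_gens I (min_gens I)"
  unfolding min_gens_def by (rule theI') (simp add: is_min_gens_iff[OF assms])

text \<open>In both exchange properties the subtraction of exponent vectors does not truncate,
  since \<open>a\<^sub>i > b\<^sub>i\<close> gives \<open>a\<^sub>i > 0\<close>.\<close>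

definition polymatroidal :: "('x, 'k::field) mpoly set \<Rightarrow> bool" where
  "polymatroidal I \<longleftrightarrow>
     (\<forall>a\<in>min_gens I. \<forall>b\<in>min_gens I. mdeg a = mdeg b) \<and>
     (\<forall>a\<in>min_gens I. \<forall>b\<in>min_gens I. \<forall>i.
        Poly_Mapping.lookup a i > Poly_Mapping.lookup b i \<longrightarrow>
        (\<exists>j. Poly_Mapping.lookup a j < Poly_Mapping.lookup b j \<and>
             a - Poly_Mapping.single i 1 + Poly_Mapping.single j 1 \<in> min_gens I))"

definition strong_exchange :: "('x, 'k::field) mpoly set \<Rightarrow> bool" where
  "strong_exchange I \<longleftrightarrow>
     (\<forall>a\<in>min_gens I. \<forall>b\<in>min_gens I. \<forall>i j.
        Poly_Mapping.lookup a i > Poly_Mapping.lookup b i \<longrightarrow>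
        Poly_Mapping.lookup a j < Poly_Mapping.lookup b j \<longrightarrow>
        a - Poly_Mapping.single i 1 + Poly_Mapping.single j 1 \<in> min_gens I)"

definition transversal :: "('x, 'k::field) mpoly set \<Rightarrow> bool" where
  "transversal I \<longleftrightarrow>
     (\<exists>Vs :: 'x set list. I = foldr (\<lambda>V. ideal_mult (ideal.span (var ` V))) Vs UNIV)"

text \<open>The lists \<open>xs\<close> and \<open>ys\<close> are the two parts of the vertex set, indexed (from 0) as the
  Ferrers condition demands.\<close>

definition ferrers_graph :: "'v set \<Rightarrow> 'v set set \<Rightarrow> bool" where
  "ferrers_graph V E \<longleftrightarrow>
     (\<exists>xs ys. distinct (xs @ ys) \<and> set (xs @ ys) = V \<and>
        E \<subseteq> {{xs ! i, ys ! j} |i j. i < length xs \<and> j < length ys} \<and>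
        (\<forall>i<length xs. \<forall>j<length ys. {xs ! i, ys ! j} \<in> E \<longrightarrow>
           (\<forall>r\<le>i. \<forall>s\<le>j. {xs ! r, ys ! s} \<in> E)))"

definition edge_ideal :: "'x set set \<Rightarrow> ('x, 'k::field) mpoly set" where
  "edge_ideal E = ideal.span {var u * var v |u v. {u, v} \<in> E}"

definition ferrers_ideal :: "('x, 'k::field) mpoly set \<Rightarrow> bool" where
  "ferrers_ideal I \<longleftrightarrow> (\<exists>E. ferrers_graph UNIV E \<and> I = edge_ideal E)"


text \<open>
  The variables adjoined to \<open>S\<close> are indexed by the minimal generators of \<open>I\<close> themselves, so
  \<open>T\<close> is the subring \<open>rees_ring I\<close> of the polynomials over \<open>S\<close> in which only those
  variables occur. Coefficients of such a polynomial are elements of \<open>S\<close>.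
\<close>

type_synonym ('x, 'k) rees_poly = "('x expo, ('x, 'k) mpoly) mpoly"

definition rees_ring :: "('x, 'k::field) mpoly set \<Rightarrow> ('x, 'k) rees_poly set" where
  "rees_ring I = {p. \<forall>u\<in>Poly_Mapping.keys p. Poly_Mapping.keys u \<subseteq> min_gens I}"

text \<open>The \<open>S\<close>-algebra homomorphism that sends the variable indexed by \<open>f\<close> to \<open>f t\<close>.\<close>

definition rees_map :: "('x, 'k::field) rees_poly \<Rightarrow> ('x, 'k) mpoly poly" where
  "rees_map p = (\<Sum>u\<in>Poly_Mapping.keys p. [:Poly_Mapping.lookup p u:] *
     (\<Prod>f\<in>Poly_Mapping.keys u. monom (monomial f) 1 ^ Poly_Mapping.lookup u f))"

definition rees_ideal :: "('x, 'k::field) mpoly set \<Rightarrow> ('x, 'k) rees_poly set" where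
  "rees_ideal I = {p \<in> rees_ring I. rees_map p = 0}"

definition bihomogeneous :: "nat \<Rightarrow> nat \<Rightarrow> ('x, 'k::field) rees_poly \<Rightarrow> bool" where
  "bihomogeneous d e p \<longleftrightarrow>
     (\<forall>u\<in>Poly_Mapping.keys p. mdeg u = e \<and>
        (\<forall>a\<in>Poly_Mapping.keys (Poly_Mapping.lookup p u). mdeg a = d))"

text \<open>The ideal generated by \<open>B\<close> in a subring \<open>T\<close>: as \<open>ideal.span\<close>, but with the coefficients
  taken from \<open>T\<close>.\<close>

definition ideal_generated_in :: "'a::comm_ring_1 set \<Rightarrow> 'a set \<Rightarrow> 'a set" where
  "ideal_generated_in T B = {\<Sum>b\<in>F. r b * b |F r. finite F \<and> F \<subseteq> B \<and> (\<forall>b\<in>F. r b \<in> T)}"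

lemma ideal_generated_in_UNIV: "ideal_generated_in UNIV B = ideal.span B"
  by (simp add: ideal_generated_in_def ideal.span_explicit)

end

theory Submission
  imports Defs "HOL-Library.Multiset"
begin

text \<open>
  The Rees ideal is spanned by binomials \<open>x\<^sup>a y\<^sub>U - x\<^sup>b y\<^sub>V\<close>, where \<open>U\<close>, \<open>V\<close> are multisets of
  generators of the same size with \<open>a + \<Sum>U = b + \<Sum>V\<close>. It therefore suffices to connect any two
  such pairs \<open>(a, U)\<close>, \<open>(b, V)\<close> by moves that either replace two members of \<open>U\<close> by two others
  with the same sum, or exchange one variable between \<open>a\<close> and one member of \<open>U\<close>.

  In the two polymatroidal cases the generators are strongly base orderable, and the argument is that of
  Lason and Michalek on White's conjecture: regard both pairs as distributions of the same labelled
  points into bins, one bin for the coefficient monomial and one for each generator. If some point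
  lies in different generator bins \<open>i\<close>, \<open>j\<close> on the two sides, strong base orderability pairs up the
  points of bins \<open>i\<close> and \<open>j\<close> on each side; a common proper 2-colouring of the two pairings
  redistributes both sides so that they agree on all points which both put into \<open>i\<close> or \<open>j\<close>.
  If every disagreement involves the coefficient bin, the exchange property moves one point into
  its place.

  For a Ferrers graph, take an edge with the largest left index occurring on either side. By the Ferrers
  condition the other side can be moved to contain the same edge, which is then cancelled.
\<close>

section \<open>Moves between monomials of equal image\<close>

text \<open>A pair \<open>(a, U)\<close> stands for the monomial \<open>x^a y_U\<close> of the Rees
  ring. A \<open>conn_quad\<close> step changes it by a multiple of a binomial of bidegree (0,2), a
  \<open>conn_lin\<close> step by a multiple of \<open>x_i y_f - x_j y_f'\<close>, of bidegree
  (1,1); in both rules \<open>x^a y_U\<close> is the common cofactor.\<close>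

inductive conn :: "'x expo set \<Rightarrow> 'x expo \<times> 'x expo multiset \<Rightarrow> 'x expo \<times> 'x expo multiset \<Rightarrow> bool"
  for M :: "'x expo set" where
  conn_refl: "conn M z z"
| conn_sym: "conn M z z' \<Longrightarrow> conn M z' z"
| conn_trans: "conn M z z' \<Longrightarrow> conn M z' z'' \<Longrightarrow> conn M z z''"
| conn_quad: "\<lbrakk>set_mset U \<subseteq> M; f \<in> M; g \<in> M; f' \<in> M; g' \<in> M; f + g = f' + g'\<rbrakk>
    \<Longrightarrow> conn M (a, U + {#f, g#}) (a, U + {#f', g'#})"
| conn_lin: "\<lbrakk>set_mset U \<subseteq> M; f \<in> M; f' \<in> M;
     Poly_Mapping.single i 1 + f = Poly_Mapping.single j 1 + f'\<rbrakk>
    \<Longrightarrow> conn M (a + Poly_Mapping.single i 1, U + {#f#}) (a + Poly_Mapping.single j 1, U + {#f'#})"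

text \<open>Each move keeps the image under the Rees map, which is determined by the total exponent
  and the number of generators. Membership in \<open>M\<close> is stated as an equivalence because
  \<open>conn_refl\<close> puts no condition on the multiset; it carries membership along symmetric
  and transitive steps.\<close>

lemma conn_invariant:
  assumes "conn M z z'"
  shows "fst z + \<Sum>\<^sub># (snd z) = fst z' + \<Sum>\<^sub># (snd z')"
    and "size (snd z) = size (snd z')"
    and "set_mset (snd z) \<subseteq> M \<longleftrightarrow> set_mset (snd z') \<subseteq> M"
proof -
  have "fst z + \<Sum>\<^sub># (snd z) = fst z' + \<Sum>\<^sub># (snd z') \<and> size (snd z) = size (snd z') \<and>
    (set_mset (snd z) \<subseteq> M \<longleftrightarrow> set_mset (snd z') \<subseteq> M)"
    using assms
  proof induction
    case (conn_quad U f g f' g' a)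
    then show ?case by (simp add: add.assoc[symmetric])
  next
    case (conn_lin U f f' i j a)
    then show ?case by (simp add: add.assoc[symmetric]) (simp add: add.assoc add.left_commute add.commute)
  qed auto
  then show "fst z + \<Sum>\<^sub># (snd z) = fst z' + \<Sum>\<^sub># (snd z')"
    and "size (snd z) = size (snd z')"
    and "set_mset (snd z) \<subseteq> M \<longleftrightarrow> set_mset (snd z') \<subseteq> M" by auto
qed

text \<open>Every move already has an arbitrary cofactor, so a whole chain of moves can be
  multiplied by a monomial. This restores a generator that was cancelled on both sides.\<close>

lemma conn_context:
  assumes "conn M (a, U) (b, V)" and "set_mset W \<subseteq> M"
  shows "conn M (a + c, U + W) (b + c, V + W)"
proof -
  have "conn M (fst z + c, snd z + W) (fst z' + c, snd z' + W)" if "conn M z z'" for z z'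
    using that
  proof induction
    case (conn_quad U f g f' g' a)
    then show ?case
      using conn.conn_quad[of "U + W" M f g f' g' "a + c"] assms(2) by (simp add: ac_simps)
  next
    case (conn_lin U f f' i j a)
    then show ?case
      using conn.conn_lin[of "U + W" M f f' i j "a + c"] assms(2) by (simp add: ac_simps)
  qed (auto intro: conn.intros)
  from this[OF assms(1)] show ?thesis by simp
qed

text \<open>Equal size and equal total exponent say that two monomials have the same image under the
  Rees map, so this is connectedness of all its fibres under the moves.\<close>

definition linked :: "'x expo set \<Rightarrow> bool" where
  "linked M \<longleftrightarrow> (\<forall>a U b V. set_mset U \<subseteq> M \<longrightarrow> set_mset V \<subseteq> M \<longrightarrow> size U = size V \<longrightarrow>
     a + \<Sum>\<^sub># U = b + \<Sum>\<^sub># V \<longrightarrow> conn M (a, U) (b, V))"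

section \<open>Exponent vectors as sums over labelled points\<close>

lemma minus_single_add:
  assumes "Poly_Mapping.lookup a i > (0::nat)"
  shows "a - Poly_Mapping.single i 1 + Poly_Mapping.single i 1 = a"
  by (rule poly_mapping_eqI)
    (use assms in \<open>auto simp: lookup_add lookup_minus lookup_single when_def\<close>)

lemma mdeg_single: "mdeg (Poly_Mapping.single i 1) = 1"
  by (simp add: mdeg_def)

lemma expo_as_sum_mset:
  fixes u :: "'a \<Rightarrow>\<^sub>0 nat"
  obtains P where "u = (\<Sum>i\<in>#P. Poly_Mapping.single i 1)"
proof -
  have "\<exists>P. u = (\<Sum>i\<in>#P. Poly_Mapping.single i 1)"
  proof (induction "mdeg u" arbitrary: u rule: less_induct)
    case less
    show ?case
    proof (cases "u = 0")
      case True
      then show ?thesis by (intro exI[of _ "{#}"]) simp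
    next
      case False
      then obtain i where "Poly_Mapping.lookup u i > 0"
        by (metis gr_zeroI lookup_zero poly_mapping_eqI)
      then have eq: "u - Poly_Mapping.single i 1 + Poly_Mapping.single i 1 = u"
        by (rule minus_single_add)
      then have "mdeg u = mdeg (u - Poly_Mapping.single i 1) + 1"
        by (metis mdeg_plus mdeg_single)
      then obtain P where "u - Poly_Mapping.single i 1 = (\<Sum>i\<in>#P. Poly_Mapping.single i 1)"
        using less[of "u - Poly_Mapping.single i 1"] by auto
      with eq show ?thesis by (intro exI[of _ "add_mset i P"]) (simp add: add.commute)
    qed
  qed
  with that show thesis by blast
qed

text \<open>\<open>p\<close> labels points by variables, and several points may carry the same
  variable. An exponent vector with multiplicities thus becomes a set of distinct points, as for a
  matroid.\<close>

definition vsum :: "('a \<Rightarrow> 'x) \<Rightarrow> 'a set \<Rightarrow> 'x expo" where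
  "vsum p S = (\<Sum>x\<in>S. Poly_Mapping.single (p x) 1)"

lemma lookup_vsum:
  assumes "finite S"
  shows "Poly_Mapping.lookup (vsum p S) k = card {x \<in> S. p x = k}"
  using assms
proof (induction S)
  case empty
  then show ?case by (simp add: vsum_def)
next
  case (insert x S)
  have "{y \<in> insert x S. p y = k} = (if p x = k then insert x else id) {y \<in> S. p y = k}" by auto
  with insert show ?case by (auto simp: vsum_def lookup_add lookup_single when_def)
qed

lemma mdeg_vsum: "mdeg (vsum p S) = card S"
proof (induction S rule: infinite_finite_induct)
  case (insert x F)
  then show ?case using mdeg_single by (simp add: vsum_def mdeg_plus)
qed (simp_all add: vsum_def mdeg_def)

lemma vsum_union_disjoint:
  "finite A \<Longrightarrow> finite B \<Longrightarrow> A \<inter> B = {} \<Longrightarrow> vsum p (A \<union> B) = vsum p A + vsum p B"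
  by (simp add: vsum_def sum.union_disjoint)

lemma vsum_insert: "finite A \<Longrightarrow> x \<notin> A \<Longrightarrow> vsum p (insert x A) = Poly_Mapping.single (p x) 1 + vsum p A"
  by (simp add: vsum_def)

text \<open>Induction on the points: the label of the point removed occurs in \<open>g\<close> or in
  \<open>h\<close>, and the point is given to a part where it does.\<close>

lemma vsum_split_add:
  assumes "finite X" and "vsum p X = g + h"
  shows "\<exists>Y\<subseteq>X. vsum p Y = g \<and> vsum p (X - Y) = h"
  using assms
proof (induction X arbitrary: g h)
  case empty
  then have "mdeg g + mdeg h = 0" by (simp add: vsum_def mdeg_plus[symmetric] mdeg_eq_0)
  then have "g = 0" "h = 0" using mdeg_eq_0 by auto
  then show ?case by (auto simp: vsum_def)
next
  case (insert x X)
  let ?e = "Poly_Mapping.single (p x) (1::nat)"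
  have eq: "?e + vsum p X = g + h" using insert by (simp add: vsum_insert)
  have "Poly_Mapping.lookup (g + h) (p x) > 0" unfolding eq[symmetric] by (simp add: lookup_add)
  then consider "Poly_Mapping.lookup g (p x) > 0" | "Poly_Mapping.lookup h (p x) > 0"
    by (auto simp: lookup_add)
  then show ?case
  proof cases
    case 1
    then obtain g' where g: "g = ?e + g'" by (metis minus_single_add add.commute)
    from eq have "?e + vsum p X = ?e + (g' + h)" by (simp only: g add.assoc)
    then have "vsum p X = g' + h" by (rule add_left_imp_eq)
    from insert.IH[OF this] obtain Y where Y: "Y \<subseteq> X" "vsum p Y = g'" "vsum p (X - Y) = h"
      by blast
    have "x \<notin> Y" "finite Y" using Y(1) insert.hyps finite_subset by auto
    then have "vsum p (insert x Y) = g" using Y g by (simp add: vsum_insert)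
    moreover have "insert x X - insert x Y = X - Y" using insert.hyps by auto
    ultimately show ?thesis using Y by (intro exI[of _ "insert x Y"]) auto
  next
    case 2
    then obtain h' where h: "h = ?e + h'" by (metis minus_single_add add.commute)
    from eq have "?e + vsum p X = ?e + (g + h')" by (simp only: h add.left_commute)
    then have "vsum p X = g + h'" by (rule add_left_imp_eq)
    from insert.IH[OF this] obtain Y where Y: "Y \<subseteq> X" "vsum p Y = g" "vsum p (X - Y) = h'"
      by blast
    have "insert x X - Y = insert x (X - Y)" using insert.hyps Y by auto
    then have "vsum p (insert x X - Y) = h"
      using Y h insert.hyps by (simp add: vsum_insert)
    then show ?thesis using Y by (intro exI[of _ Y]) auto
  qed
qed

text \<open>Summands are peeled off one at a time by \<open>vsum_split_add\<close>. In this way any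
  factorization of a monomial is realised by sorting its points into bins.\<close>

lemma vsum_distribute:
  assumes "finite I" and "finite X" and "vsum p X = (\<Sum>i\<in>I. g i)"
  shows "\<exists>\<beta>. (\<forall>x\<in>X. \<beta> x \<in> I) \<and> (\<forall>i\<in>I. vsum p {x \<in> X. \<beta> x = i} = g i)"
  using assms
proof (induction I arbitrary: X)
  case empty
  then have "card X = 0" by (metis mdeg_eq_0 mdeg_vsum sum.empty)
  with empty show ?case by auto
next
  case (insert i I)
  then obtain Y where Y: "Y \<subseteq> X" "vsum p Y = g i" "vsum p (X - Y) = (\<Sum>i\<in>I. g i)"
    using vsum_split_add[of X p "g i" "\<Sum>i\<in>I. g i"] by auto
  from insert.IH[of "X - Y"] Y insert.prems obtain \<beta>
    where \<beta>: "\<forall>x\<in>X - Y. \<beta> x \<in> I" "\<forall>i\<in>I. vsum p {x \<in> X - Y. \<beta> x = i} = g i" by auto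
  let ?\<beta> = "\<lambda>x. if x \<in> Y then i else \<beta> x"
  have "{x \<in> X. ?\<beta> x = i} = Y" using Y \<beta> insert.hyps by auto
  moreover have "{x \<in> X. ?\<beta> x = k} = {x \<in> X - Y. \<beta> x = k}" if "k \<in> I" for k
    using that insert.hyps by auto
  ultimately show ?case using \<beta> Y by (intro exI[of _ ?\<beta>]) auto
qed

section \<open>Strongly base orderable polymatroids\<close>

text \<open>\<open>s\<close> and \<open>t\<close> are perfect matchings of \<open>A\<close> and
  \<open>B\<close>. In their union edges alternate along every path and cycle, so cycles are even
  and a proper 2-colouring exists. The induction removes one \<open>s\<close>-edge and repairs
  \<open>t\<close> around it.\<close>

lemma two_matchings_colouring:
  fixes A B :: "'a::linorder set"
  assumes "finite A"
    and "\<And>x. x \<in> A \<Longrightarrow> s x \<in> A" "\<And>x. x \<in> A \<Longrightarrow> s x \<noteq> x" "\<And>x. x \<in> A \<Longrightarrow> s (s x) = x"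
    and "\<And>x. x \<in> B \<Longrightarrow> t x \<in> B" "\<And>x. x \<in> B \<Longrightarrow> t x \<noteq> x" "\<And>x. x \<in> B \<Longrightarrow> t (t x) = x"
  shows "\<exists>C. (\<forall>x\<in>A. s x \<in> C \<longleftrightarrow> x \<notin> C) \<and> (\<forall>x\<in>B. t x \<in> C \<longleftrightarrow> x \<notin> C)"
  using assms
proof (induction "card A" arbitrary: A B t rule: less_induct)
  case less
  note s = less.prems(2-4) and t = less.prems(5-7)
  show ?case
  proof (cases "A = {}")
    case True
    \<comment> \<open>With no \<open>s\<close>-edges left, the order on the type selects the smaller
      end of each \<open>t\<close>-edge.\<close>
    have "t x \<in> {x. x < t x} \<longleftrightarrow> x \<notin> {x. x < t x}" if "x \<in> B" for x
      using t(2,3)[OF that] by auto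
    with True show ?thesis by blast
  next
    case False
    then obtain x where x: "x \<in> A" by blast
    define y where "y = s x"
    have y: "y \<in> A" "y \<noteq> x" "s y = x" using s x by (auto simp: y_def)
    let ?A = "A - {x, y}"
    have sA: "s z \<in> ?A" if "z \<in> ?A" for z
      using that s x y by (metis Diff_iff empty_iff insert_iff)
    have "card ?A < card A" using less.prems(1) x by (intro psubset_card_mono) auto
    note IH = less.hyps[OF this]
    have ex: "\<exists>C. (\<forall>z\<in>?A. s z \<in> C \<longleftrightarrow> z \<notin> C) \<and> (\<forall>z\<in>B'. t' z \<in> C \<longleftrightarrow> z \<notin> C)"
      if "\<And>z. z \<in> B' \<Longrightarrow> t' z \<in> B'" "\<And>z. z \<in> B' \<Longrightarrow> t' z \<noteq> z" "\<And>z. z \<in> B' \<Longrightarrow> t' (t' z) = z"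
      for B' t'
      by (rule IH) (use sA s less.prems(1) that in auto)
    \<comment> \<open>A colouring that is proper on the remaining \<open>s\<close>-edges may be
      changed at \<open>x\<close> and \<open>y\<close>, provided these get opposite colours and
      \<open>t\<close> stays properly coloured.\<close>
    have extend: ?thesis
      if C: "\<forall>z\<in>?A. s z \<in> C \<longleftrightarrow> z \<notin> C"
        and C': "\<And>z. z \<notin> {x, y} \<Longrightarrow> z \<in> C' \<longleftrightarrow> z \<in> C" "x \<in> C' \<longleftrightarrow> y \<notin> C'"
        and B: "\<forall>z\<in>B. t z \<in> C' \<longleftrightarrow> z \<notin> C'" for C C'
    proof (intro exI[of _ C'] conjI B, rule ballI)
      fix z assume z: "z \<in> A"
      show "s z \<in> C' \<longleftrightarrow> z \<notin> C'"
      proof (cases "z \<in> {x, y}")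
        case True
        then have "z = x \<and> s z = y \<or> z = y \<and> s z = x" using y(3) by (auto simp: y_def)
        with C'(2) show ?thesis by metis
      next
        case False
        with z sA[of z] C C'(1) show ?thesis by auto
      qed
    qed
    have inj: "t a = t b \<longleftrightarrow> a = b" if "a \<in> B" "b \<in> B" for a b using t(3) that by metis
    \<comment> \<open>The cases record how \<open>t\<close> meets the removed edge
      \<open>x - y\<close>: the same edge, two different edges, an edge at one end only, or no
      edge.\<close>
    consider "x \<in> B" "t x = y" | "x \<in> B" "y \<in> B" "t x \<noteq> y" | "x \<in> B" "y \<notin> B"
      | "x \<notin> B" "y \<in> B" | "x \<notin> B" "y \<notin> B" by blast
    then show ?thesis
    proof cases
      case 1
      have yx: "y \<in> B" "t y = x" using 1 t by auto
      have *: "t z \<in> B - {x, y}" if "z \<in> B - {x, y}" for z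
        using that t 1 yx by (metis Diff_iff empty_iff insert_iff)
      obtain C where C: "\<forall>z\<in>?A. s z \<in> C \<longleftrightarrow> z \<notin> C" "\<forall>z\<in>B - {x, y}. t z \<in> C \<longleftrightarrow> z \<notin> C"
        using ex[of "B - {x, y}" t] * t by auto
      show ?thesis
      proof (rule extend[OF C(1), of "insert x (C - {y})"])
        show "\<forall>z\<in>B. t z \<in> insert x (C - {y}) \<longleftrightarrow> z \<notin> insert x (C - {y})"
        proof
          fix z assume z: "z \<in> B"
          consider "z = x" | "z = y" | "z \<in> B - {x, y}" using z by auto
          then show "t z \<in> insert x (C - {y}) \<longleftrightarrow> z \<notin> insert x (C - {y})"
          proof cases
            case 3
            from *[OF 3] C(2) 3 show ?thesis by auto
          qed (use 1 yx y in simp_all)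
        qed
      qed (use y in auto)
    next
      case 2
      text \<open>The path \<open>t x - x - y - t y\<close> is contracted to a single edge between \<open>t x\<close> and \<open>t y\<close>.\<close>
      let ?t = "t(t x := t y, t y := t x)"
      have ne: "t x \<noteq> t y" "t y \<noteq> x" "t x \<noteq> x" "t y \<noteq> y" using 2 t y inj by metis+
      have *: "t z \<notin> {x, y, t x, t y}" if "z \<in> B - {x, y, t x, t y}" for z
        using that t 2 by (metis Diff_iff empty_iff insert_iff)
      obtain C where C: "\<forall>z\<in>?A. s z \<in> C \<longleftrightarrow> z \<notin> C" "\<forall>z\<in>B - {x, y}. ?t z \<in> C \<longleftrightarrow> z \<notin> C"
      proof -
        have "\<exists>C. (\<forall>z\<in>?A. s z \<in> C \<longleftrightarrow> z \<notin> C) \<and> (\<forall>z\<in>B - {x, y}. ?t z \<in> C \<longleftrightarrow> z \<notin> C)"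
        proof (rule ex)
          fix z assume z: "z \<in> B - {x, y}"
          consider "z = t x" | "z = t y" | "z \<in> B - {x, y, t x, t y}" using z by auto
          note cs = this
          show "?t z \<in> B - {x, y}" using cs by cases (use 2 t ne * in auto)
          show "?t z \<noteq> z" using cs by cases (use 2 t ne * in auto)
          show "?t (?t z) = z" using cs by cases (use 2 t ne * in auto)
        qed
        with that show thesis by blast
      qed
      have opp: "t x \<in> C \<longleftrightarrow> t y \<notin> C" using C(2)[rule_format, of "t x"] 2 t ne by auto
      \<comment> \<open>\<open>x\<close> and \<open>y\<close> are coloured against their
        \<open>t\<close>-partners. The contracted edge gave these partners opposite colours, so
        \<open>x\<close> and \<open>y\<close> differ as well.\<close>
      let ?C = "{z. if z = x then t x \<notin> C else if z = y then t y \<notin> C else z \<in> C}"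
      show ?thesis
      proof (rule extend[OF C(1), of ?C])
        show "\<forall>z\<in>B. t z \<in> ?C \<longleftrightarrow> z \<notin> ?C"
        proof
          fix z assume z: "z \<in> B"
          consider "z = x" | "z = y" | "z = t x" | "z = t y" | "z \<in> B - {x, y, t x, t y}"
            using z by auto
          then show "t z \<in> ?C \<longleftrightarrow> z \<notin> ?C"
            by cases (use 2 t ne * C(2)[rule_format, of z] y in auto)
        qed
      qed (use opp y in auto)
    next
      case 3
      have *: "t z \<in> B - {x, t x}" if "z \<in> B - {x, t x}" for z
        using that t 3 by (metis Diff_iff empty_iff insert_iff)
      obtain C where C: "\<forall>z\<in>?A. s z \<in> C \<longleftrightarrow> z \<notin> C" "\<forall>z\<in>B - {x, t x}. t z \<in> C \<longleftrightarrow> z \<notin> C"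
        using ex[of "B - {x, t x}" t] * t by auto
      have ne: "t x \<noteq> x" "t x \<noteq> y" "t x \<in> B" "t (t x) = x" using 3 t by auto
      \<comment> \<open>The edge \<open>x - t x\<close> was left out of \<open>t\<close>. Now
        \<open>x\<close> is coloured against \<open>t x\<close>, and \<open>y\<close>, on which
        \<open>t\<close> imposes nothing, against \<open>x\<close>.\<close>
      let ?C = "{z. if z = x then t x \<notin> C else if z = y then t x \<in> C else z \<in> C}"
      show ?thesis
      proof (rule extend[OF C(1), of ?C])
        show "\<forall>z\<in>B. t z \<in> ?C \<longleftrightarrow> z \<notin> ?C"
        proof
          fix z assume z: "z \<in> B"
          consider "z = x" | "z = t x" | "z \<in> B - {x, t x}" using z by auto
          then show "t z \<in> ?C \<longleftrightarrow> z \<notin> ?C"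
            by cases (use 3 ne *[of z] C(2)[rule_format, of z] y in auto)
        qed
      qed (use y in auto)
    next
      case 4
      have *: "t z \<in> B - {y, t y}" if "z \<in> B - {y, t y}" for z
        using that t 4 by (metis Diff_iff empty_iff insert_iff)
      obtain C where C: "\<forall>z\<in>?A. s z \<in> C \<longleftrightarrow> z \<notin> C" "\<forall>z\<in>B - {y, t y}. t z \<in> C \<longleftrightarrow> z \<notin> C"
        using ex[of "B - {y, t y}" t] * t by auto
      have ne: "t y \<noteq> y" "t y \<noteq> x" "t y \<in> B" "t (t y) = y" using 4 t by auto
      let ?C = "{z. if z = y then t y \<notin> C else if z = x then t y \<in> C else z \<in> C}"
      show ?thesis
      proof (rule extend[OF C(1), of ?C])
        show "\<forall>z\<in>B. t z \<in> ?C \<longleftrightarrow> z \<notin> ?C"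
        proof
          fix z assume z: "z \<in> B"
          consider "z = y" | "z = t y" | "z \<in> B - {y, t y}" using z by auto
          then show "t z \<in> ?C \<longleftrightarrow> z \<notin> ?C"
            by cases (use 4 ne *[of z] C(2)[rule_format, of z] y in auto)
        qed
      qed (use y in auto)
    next
      case 5
      obtain C where C: "\<forall>z\<in>?A. s z \<in> C \<longleftrightarrow> z \<notin> C" "\<forall>z\<in>B. t z \<in> C \<longleftrightarrow> z \<notin> C"
        using ex[of B t] t by auto
      show ?thesis
      proof (rule extend[OF C(1), of "insert x (C - {y})"])
        show "\<forall>z\<in>B. t z \<in> insert x (C - {y}) \<longleftrightarrow> z \<notin> insert x (C - {y})"
        proof
          fix z assume z: "z \<in> B"
          then have "t z \<notin> {x, y}" "z \<notin> {x, y}" using 5 t(1)[OF z] by auto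
          with C(2) z show "t z \<in> insert x (C - {y}) \<longleftrightarrow> z \<notin> insert x (C - {y})" by auto
        qed
      qed (use y in auto)
    qed
  qed
qed

section \<open>Strong base orderability and common colourings of two pairings\<close>

definition splits_pairing :: "'a set \<Rightarrow> ('a \<Rightarrow> 'a) \<Rightarrow> 'a set \<Rightarrow> bool" where
  "splits_pairing A \<sigma> S \<longleftrightarrow> (\<forall>x\<in>A. \<sigma> x \<in> S \<longleftrightarrow> x \<notin> S)"

text \<open>Strong base orderability, for bases given as multisets of labelled points.\<close>

definition base_orderable :: "'x expo set \<Rightarrow> bool" where
  "base_orderable M \<longleftrightarrow> (\<forall>(p :: nat \<Rightarrow> 'x) X Y. finite X \<longrightarrow> finite Y \<longrightarrow> X \<inter> Y = {} \<longrightarrow>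
     vsum p X \<in> M \<longrightarrow> vsum p Y \<in> M \<longrightarrow>
     (\<exists>\<sigma>. bij_betw \<sigma> X Y \<and> (\<forall>S\<subseteq>X \<union> Y. splits_pairing X \<sigma> S \<longrightarrow> vsum p S \<in> M)))"

definition exchange_property :: "'x expo set \<Rightarrow> bool" where
  "exchange_property M \<longleftrightarrow> (\<forall>a\<in>M. \<forall>b\<in>M. mdeg a = mdeg b) \<and>
     (\<forall>a\<in>M. \<forall>b\<in>M. \<forall>i. Poly_Mapping.lookup a i > Poly_Mapping.lookup b i \<longrightarrow>
        (\<exists>j. Poly_Mapping.lookup a j < Poly_Mapping.lookup b j \<and>
             a - Poly_Mapping.single i 1 + Poly_Mapping.single j 1 \<in> M))"

text \<open>A bijection between disjoint sets, glued to its inverse, is a fixed-point-free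
  involution of their union, so \<open>two_matchings_colouring\<close> applies to the two
  involutions.\<close>

lemma two_pairings_colouring:
  fixes \<sigma> \<tau> :: "nat \<Rightarrow> nat"
  assumes "finite X" "X \<inter> Y = {}" "bij_betw \<sigma> X Y" "X' \<inter> Y' = {}" "bij_betw \<tau> X' Y'"
  shows "\<exists>C. splits_pairing X \<sigma> C \<and> splits_pairing X' \<tau> C"
proof -
  define s where "s \<sigma> X x = (if x \<in> X then \<sigma> x else inv_into X \<sigma> x)" for \<sigma> :: "nat \<Rightarrow> nat" and X x
  have s: "s \<sigma> X x \<in> X \<union> Y" "s \<sigma> X x \<noteq> x" "s \<sigma> X (s \<sigma> X x) = x"
    if b: "bij_betw \<sigma> X Y" and d: "X \<inter> Y = {}" and x: "x \<in> X \<union> Y" for \<sigma> X Y x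
  proof -
    have "s \<sigma> X x \<in> X \<union> Y \<and> s \<sigma> X x \<noteq> x \<and> s \<sigma> X (s \<sigma> X x) = x"
    proof (cases "x \<in> X")
      case True
      then have y: "\<sigma> x \<in> Y" using b by (auto simp: bij_betw_def)
      with d True have "\<sigma> x \<notin> X" by auto
      with True y b show ?thesis by (auto simp: s_def bij_betw_def)
    next
      case False
      with x have "x \<in> Y" by auto
      then have "inv_into X \<sigma> x \<in> X" "\<sigma> (inv_into X \<sigma> x) = x"
        using b by (auto simp: bij_betw_def f_inv_into_f inv_into_into)
      with False show ?thesis by (auto simp: s_def)
    qed
    then show "s \<sigma> X x \<in> X \<union> Y" "s \<sigma> X x \<noteq> x" "s \<sigma> X (s \<sigma> X x) = x" by auto
  qed
  have "finite (X \<union> Y)" using assms(1,3) bij_betw_finite by auto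
  then have "\<exists>C. (\<forall>x\<in>X \<union> Y. s \<sigma> X x \<in> C \<longleftrightarrow> x \<notin> C) \<and> (\<forall>x\<in>X' \<union> Y'. s \<tau> X' x \<in> C \<longleftrightarrow> x \<notin> C)"
    using s[OF assms(3,2)] s[OF assms(5,4)] by (rule two_matchings_colouring)
  then obtain C where C: "\<forall>x\<in>X \<union> Y. s \<sigma> X x \<in> C \<longleftrightarrow> x \<notin> C" "\<forall>x\<in>X' \<union> Y'. s \<tau> X' x \<in> C \<longleftrightarrow> x \<notin> C"
    by blast
  have "splits_pairing X \<sigma> C" "splits_pairing X' \<tau> C"
    unfolding splits_pairing_def using C by (metis UnI1 s_def)+
  then show ?thesis by blast
qed

text \<open>Base orderability pairs bins \<open>i\<close> and \<open>j\<close> under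
  \<open>\<beta>\<close> and again under \<open>\<delta>\<close>. If \<open>C\<close> properly
  2-colours both pairings, then \<open>C\<close> and its complement each contain exactly one point
  of every pair, so all four colour classes are bases.\<close>

lemma base_orderable_colour_swap:
  assumes "base_orderable M" "finite X"
    and "vsum p {x \<in> X. \<beta> x = i} \<in> M" "vsum p {x \<in> X. \<beta> x = j} \<in> M" "i \<noteq> (j :: nat)"
    and "vsum p {x \<in> X. \<delta> x = i} \<in> M" "vsum p {x \<in> X. \<delta> x = j} \<in> M"
  obtains C :: "nat set" where
    "vsum p {x \<in> X. \<beta> x \<in> {i, j} \<and> x \<in> C} \<in> M" "vsum p {x \<in> X. \<beta> x \<in> {i, j} \<and> x \<notin> C} \<in> M"
    "vsum p {x \<in> X. \<delta> x \<in> {i, j} \<and> x \<in> C} \<in> M" "vsum p {x \<in> X. \<delta> x \<in> {i, j} \<and> x \<notin> C} \<in> M"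
proof -
  have ex: "\<exists>\<sigma>. bij_betw \<sigma> {x \<in> X. \<beta> x = i} {x \<in> X. \<beta> x = j} \<and>
      (\<forall>S. S \<subseteq> {x \<in> X. \<beta> x = i} \<union> {x \<in> X. \<beta> x = j} \<longrightarrow> splits_pairing {x \<in> X. \<beta> x = i} \<sigma> S
        \<longrightarrow> vsum p S \<in> M)"
    if "vsum p {x \<in> X. \<beta> x = i} \<in> M" "vsum p {x \<in> X. \<beta> x = j} \<in> M" for \<beta> :: "nat \<Rightarrow> nat"
  proof -
    have "{x \<in> X. \<beta> x = i} \<inter> {x \<in> X. \<beta> x = j} = {}" using assms(5) by auto
    with that assms(2) show ?thesis
      by (intro assms(1)[unfolded base_orderable_def, rule_format]) auto
  qed
  obtain \<sigma> where \<sigma>: "bij_betw \<sigma> {x \<in> X. \<beta> x = i} {x \<in> X. \<beta> x = j}"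
      "\<And>S. S \<subseteq> {x \<in> X. \<beta> x = i} \<union> {x \<in> X. \<beta> x = j} \<Longrightarrow> splits_pairing {x \<in> X. \<beta> x = i} \<sigma> S
        \<Longrightarrow> vsum p S \<in> M"
    using ex[OF assms(3,4)] by blast
  obtain \<tau> where \<tau>: "bij_betw \<tau> {x \<in> X. \<delta> x = i} {x \<in> X. \<delta> x = j}"
      "\<And>S. S \<subseteq> {x \<in> X. \<delta> x = i} \<union> {x \<in> X. \<delta> x = j} \<Longrightarrow> splits_pairing {x \<in> X. \<delta> x = i} \<tau> S
        \<Longrightarrow> vsum p S \<in> M"
    using ex[OF assms(6,7)] by blast
  have fin: "finite {x \<in> X. \<beta> x = i}" using assms(2) by simp
  have dis: "{x \<in> X. \<beta> x = i} \<inter> {x \<in> X. \<beta> x = j} = {}" "{x \<in> X. \<delta> x = i} \<inter> {x \<in> X. \<delta> x = j} = {}"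
    using assms(5) by auto
  obtain C where C: "splits_pairing {x \<in> X. \<beta> x = i} \<sigma> C" "splits_pairing {x \<in> X. \<delta> x = i} \<tau> C"
    using two_pairings_colouring[OF fin dis(1) \<sigma>(1) dis(2) \<tau>(1)] by blast
  have m: "\<And>x. x \<in> X \<Longrightarrow> \<beta> x = i \<Longrightarrow> \<sigma> x \<in> X \<and> \<beta> (\<sigma> x) = j"
    "\<And>x. x \<in> X \<Longrightarrow> \<delta> x = i \<Longrightarrow> \<tau> x \<in> X \<and> \<delta> (\<tau> x) = j"
    using \<sigma>(1) \<tau>(1) by (auto simp: bij_betw_def)
  show thesis
    by (rule that[of C]; rule \<sigma>(2) \<tau>(2)) (use C m in \<open>auto simp: splits_pairing_def\<close>)
qed

text \<open>Bin 0 holds the coefficient monomial, bins \<open>1, \<dots>, n\<close> the generators.\<close>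

definition bin_config :: "(nat \<Rightarrow> 'x) \<Rightarrow> nat set \<Rightarrow> nat \<Rightarrow> (nat \<Rightarrow> nat) \<Rightarrow> 'x expo \<times> 'x expo multiset" where
  "bin_config p X n \<beta> = (vsum p {x \<in> X. \<beta> x = 0},
     image_mset (\<lambda>i. vsum p {x \<in> X. \<beta> x = i}) (mset_set {1..n}))"

lemma bin_config_cong:
  assumes "\<And>x. x \<in> X \<Longrightarrow> \<beta> x = \<delta> x"
  shows "bin_config p X n \<beta> = bin_config p X n \<delta>"
proof -
  have "{x \<in> X. \<beta> x = i} = {x \<in> X. \<delta> x = i}" for i using assms by auto
  then show ?thesis by (simp add: bin_config_def)
qed

lemma bin_config_remove:
  assumes "i \<in> {1..n}"
  shows "bin_config p X n \<beta> = (vsum p {x \<in> X. \<beta> x = 0},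
     image_mset (\<lambda>i. vsum p {x \<in> X. \<beta> x = i}) (mset_set ({1..n} - {i})) + {#vsum p {x \<in> X. \<beta> x = i}#})"
proof -
  have "mset_set {1..n} = mset_set ({1..n} - {i}) + {#i#}"
    using assms by (metis finite_atLeastAtMost mset_set.remove add_mset_add_single)
  then show ?thesis by (simp add: bin_config_def)
qed

lemma bin_config_remove2:
  assumes "i \<in> {1..n}" "j \<in> {1..n}" "i \<noteq> j"
  shows "bin_config p X n \<beta> = (vsum p {x \<in> X. \<beta> x = 0},
     image_mset (\<lambda>i. vsum p {x \<in> X. \<beta> x = i}) (mset_set ({1..n} - {i, j}))
       + {#vsum p {x \<in> X. \<beta> x = i}, vsum p {x \<in> X. \<beta> x = j}#})"
proof -
  have "mset_set ({1..n} - {i}) = add_mset j (mset_set ({1..n} - {i} - {j}))"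
    using assms by (intro mset_set.remove) auto
  moreover have "{1..n} - {i} - {j} = {1..n} - {i, j}" by auto
  ultimately show ?thesis using assms by (simp add: bin_config_remove)
qed

text \<open>The new bin of a point from bins \<open>i\<close> or \<open>j\<close> depends on
  \<open>C\<close> alone. Two distributions recoloured with the same \<open>C\<close> therefore
  agree on every point that both of them keep in these two bins.\<close>

definition recolour :: "nat \<Rightarrow> nat \<Rightarrow> nat set \<Rightarrow> (nat \<Rightarrow> nat) \<Rightarrow> nat \<Rightarrow> nat" where
  "recolour i j C \<beta> x = (if \<beta> x \<in> {i, j} then if x \<in> C then i else j else \<beta> x)"

text \<open>Recolouring redistributes the pooled points of bins \<open>i\<close> and
  \<open>j\<close> and leaves all other bins alone, so it is a single quadratic move.\<close>

lemma conn_recolour: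
  assumes "finite X" "i \<in> {1..n}" "j \<in> {1..n}" "i \<noteq> j"
    and \<beta>: "\<forall>i\<in>{1..n}. vsum p {x \<in> X. \<beta> x = i} \<in> M"
    and C: "vsum p {x \<in> X. \<beta> x \<in> {i, j} \<and> x \<in> C} \<in> M" "vsum p {x \<in> X. \<beta> x \<in> {i, j} \<and> x \<notin> C} \<in> M"
  shows "conn M (bin_config p X n \<beta>) (bin_config p X n (recolour i j C \<beta>))"
    and "\<forall>k\<in>{1..n}. vsum p {x \<in> X. recolour i j C \<beta> x = k} \<in> M"
proof -
  let ?\<beta> = "recolour i j C \<beta>"
  have eqs: "{x \<in> X. ?\<beta> x = i} = {x \<in> X. \<beta> x \<in> {i, j} \<and> x \<in> C}"
    "{x \<in> X. ?\<beta> x = j} = {x \<in> X. \<beta> x \<in> {i, j} \<and> x \<notin> C}"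
    using assms(4) by (auto simp: recolour_def)
  have same: "{x \<in> X. ?\<beta> x = k} = {x \<in> X. \<beta> x = k}" if "k \<notin> {i, j}" for k
    using that by (auto simp: recolour_def)
  have "vsum p {x \<in> X. ?\<beta> x = i} + vsum p {x \<in> X. ?\<beta> x = j} = vsum p {x \<in> X. \<beta> x \<in> {i, j}}"
    unfolding eqs using assms(1)
    by (subst vsum_union_disjoint[symmetric]) (auto intro: arg_cong[of _ _ "vsum p"])
  also have "\<dots> = vsum p {x \<in> X. \<beta> x = i} + vsum p {x \<in> X. \<beta> x = j}"
    using assms(1,4)
    by (subst vsum_union_disjoint[symmetric]) (auto intro: arg_cong[of _ _ "vsum p"])
  finally have sum: "vsum p {x \<in> X. ?\<beta> x = i} + vsum p {x \<in> X. ?\<beta> x = j} =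
    vsum p {x \<in> X. \<beta> x = i} + vsum p {x \<in> X. \<beta> x = j}" .
  have M: "\<forall>k\<in>{1..n}. vsum p {x \<in> X. ?\<beta> x = k} \<in> M"
  proof
    fix k assume "k \<in> {1..n}"
    then show "vsum p {x \<in> X. ?\<beta> x = k} \<in> M"
      using C \<beta> same[of k] eqs by (cases "k \<in> {i, j}") auto
  qed
  have rest: "image_mset (\<lambda>k. vsum p {x \<in> X. ?\<beta> x = k}) (mset_set ({1..n} - {i, j})) =
    image_mset (\<lambda>k. vsum p {x \<in> X. \<beta> x = k}) (mset_set ({1..n} - {i, j}))"
    using same by (intro image_mset_cong) auto
  have zero: "{x \<in> X. ?\<beta> x = 0} = {x \<in> X. \<beta> x = 0}" using assms(2,3) by (intro same) auto
  show "conn M (bin_config p X n \<beta>) (bin_config p X n ?\<beta>)"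
    unfolding bin_config_remove2[OF assms(2-4)] rest zero
    by (rule conn_quad[OF _ _ _ _ _ sum[symmetric]]) (use \<beta> M assms(2,3) in auto)
  show "\<forall>k\<in>{1..n}. vsum p {x \<in> X. recolour i j C \<beta> x = k} \<in> M" by (fact M)
qed

text \<open>Interchanging \<open>x\<close> in bin \<open>i\<close> with \<open>y\<close> in the
  coefficient bin is a single linear move; the last assumption says that the new content of bin
  \<open>i\<close> is again a generator.\<close>

lemma conn_exchange_with_coefficient:
  assumes "finite X" "i \<in> {1..n}" "x \<in> X" "y \<in> X" "\<beta> x = i" "\<beta> y = 0"
    and \<beta>: "\<forall>i\<in>{1..n}. vsum p {x \<in> X. \<beta> x = i} \<in> M"
    and mem: "vsum p {x \<in> X. \<beta> x = i} - Poly_Mapping.single (p x) 1 + Poly_Mapping.single (p y) 1 \<in> M"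
  shows "conn M (bin_config p X n \<beta>) (bin_config p X n (\<beta>(x := 0, y := i)))"
    and "\<forall>k\<in>{1..n}. vsum p {z \<in> X. (\<beta>(x := 0, y := i)) z = k} \<in> M"
proof -
  let ?\<beta> = "\<beta>(x := 0, y := i)"
  define R where "R = {z \<in> X. \<beta> z = i} - {x}"
  define Q where "Q = {z \<in> X. \<beta> z = 0} - {y}"
  have i: "i \<noteq> 0" "x \<noteq> y" using assms by auto
  have sets: "{z \<in> X. \<beta> z = i} = insert x R" "{z \<in> X. \<beta> z = 0} = insert y Q"
    "{z \<in> X. ?\<beta> z = i} = insert y R" "{z \<in> X. ?\<beta> z = 0} = insert x Q"
    using assms(3-6) i by (auto simp: R_def Q_def)
  have notin: "x \<notin> R" "y \<notin> R" "x \<notin> Q" "y \<notin> Q" "finite R" "finite Q"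
    using assms i by (auto simp: R_def Q_def)
  have v: "vsum p {z \<in> X. \<beta> z = i} = Poly_Mapping.single (p x) 1 + vsum p R"
    "vsum p {z \<in> X. \<beta> z = 0} = vsum p Q + Poly_Mapping.single (p y) 1"
    "vsum p {z \<in> X. ?\<beta> z = i} = Poly_Mapping.single (p y) 1 + vsum p R"
    "vsum p {z \<in> X. ?\<beta> z = 0} = vsum p Q + Poly_Mapping.single (p x) 1"
    unfolding sets using notin by (simp_all add: vsum_insert add.commute)
  have same: "{z \<in> X. ?\<beta> z = k} = {z \<in> X. \<beta> z = k}" if "k \<notin> {0, i}" for k
    using that assms(5,6) by auto
  have Mi: "vsum p {z \<in> X. ?\<beta> z = i} \<in> M"
    using mem unfolding v(1,3) by (simp add: add.commute)
  have M: "\<forall>k\<in>{1..n}. vsum p {z \<in> X. ?\<beta> z = k} \<in> M"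
  proof
    fix k assume k: "k \<in> {1..n}"
    show "vsum p {z \<in> X. ?\<beta> z = k} \<in> M"
    proof (cases "k = i")
      case True
      then show ?thesis using Mi by simp
    next
      case False
      with k have "k \<notin> {0, i}" by auto
      from same[OF this] show ?thesis using \<beta> k by metis
    qed
  qed
  have rest: "image_mset (\<lambda>k. vsum p {z \<in> X. ?\<beta> z = k}) (mset_set ({1..n} - {i})) =
    image_mset (\<lambda>k. vsum p {z \<in> X. \<beta> z = k}) (mset_set ({1..n} - {i}))"
    using same by (intro image_mset_cong) auto
  have swap: "Poly_Mapping.single (p y) 1 + vsum p {z \<in> X. \<beta> z = i} =
      Poly_Mapping.single (p x) 1 + vsum p {z \<in> X. ?\<beta> z = i}"
    unfolding v by (rule add.left_commute)
  show "conn M (bin_config p X n \<beta>) (bin_config p X n ?\<beta>)"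
    unfolding bin_config_remove[OF assms(2)] v(2,4) rest
    by (rule conn_lin[OF _ _ _ swap]) (use \<beta> M assms(2) in auto)
  show "\<forall>k\<in>{1..n}. vsum p {z \<in> X. ?\<beta> z = k} \<in> M" by (fact M)
qed

section \<open>Exchange towards a second base, and induction on the disagreements\<close>

lemma vsum_Int_Diff: "finite B \<Longrightarrow> vsum p B = vsum p (B \<inter> D) + vsum p (B - D)"
  unfolding vsum_def by (rule sum.Int_Diff)

lemma label_more_often:
  assumes "finite S" "finite T"
    and "Poly_Mapping.lookup (vsum p T) k < Poly_Mapping.lookup (vsum p S) k"
  shows "\<exists>z\<in>S - T. p z = k"
proof (rule ccontr)
  assume "\<not> ?thesis"
  then have "{z \<in> S. p z = k} \<subseteq> {z \<in> T. p z = k}" by auto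
  then have "card {z \<in> S. p z = k} \<le> card {z \<in> T. p z = k}" using assms(2) by (intro card_mono) auto
  with assms show False by (simp add: lookup_vsum)
qed

text \<open>The exchange property transferred from exponent vectors to points. If the vectors
  differ, it supplies two labels, and counting finds points with these labels in the two
  differences. If they coincide, the differences carry the same labels equally often, and exchanging
  equally labelled points does not change the vector.\<close>

lemma exchange_towards:
  assumes M: "exchange_property M" and fin: "finite B" "finite D"
    and BD: "vsum p B \<in> M" "vsum p D \<in> M" "B \<noteq> D"
  shows "\<exists>x\<in>B - D. \<exists>y\<in>D - B.
    vsum p B - Poly_Mapping.single (p x) 1 + Poly_Mapping.single (p y) 1 \<in> M"
proof -
  have card: "card B = card D" using M BD by (metis exchange_property_def mdeg_vsum)
  show ?thesis
  proof (cases "vsum p B = vsum p D")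
    case True
    have "\<not> B \<subseteq> D" using card fin BD(3) card_subset_eq by metis
    then obtain x where x: "x \<in> B - D" by blast
    have "vsum p (B \<inter> D) + vsum p (B - D) = vsum p (B \<inter> D) + vsum p (D - B)"
      using True vsum_Int_Diff[OF fin(1), of p D] vsum_Int_Diff[OF fin(2), of p B]
      by (simp only: Int_commute[of D B])
    then have eq: "vsum p (B - D) = vsum p (D - B)" by (rule add_left_imp_eq)
    have "card {z \<in> D - B. p z = p x} = card {z \<in> B - D. p z = p x}"
      unfolding lookup_vsum[OF finite_Diff[OF fin(1)], symmetric]
        lookup_vsum[OF finite_Diff[OF fin(2)], symmetric] eq ..
    moreover have "card {z \<in> B - D. p z = p x} > 0" using x fin by (auto simp: card_gt_0_iff)
    ultimately have "{z \<in> D - B. p z = p x} \<noteq> {}" by (metis card.empty less_numeral_extra(3))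
    then obtain y where y: "y \<in> D - B" "p y = p x" by blast
    have "{z \<in> B. p z = p x} \<noteq> {}" using x by auto
    then have "Poly_Mapping.lookup (vsum p B) (p x) > 0"
      using fin by (simp add: lookup_vsum card_gt_0_iff)
    then have "vsum p B - Poly_Mapping.single (p x) 1 + Poly_Mapping.single (p y) 1 \<in> M"
      using minus_single_add BD(1) unfolding y(2) by metis
    with x y show ?thesis by blast
  next
    case False
    \<comment> \<open>Two vectors of equal degree cannot be comparable without being equal.\<close>
    obtain k where k: "Poly_Mapping.lookup (vsum p D) k < Poly_Mapping.lookup (vsum p B) k"
    proof (rule ccontr)
      assume "\<not> thesis"
      with that have le: "Poly_Mapping.lookup (vsum p B) k \<le> Poly_Mapping.lookup (vsum p D) k" for k
        by (meson not_less)
      have sum: "vsum p B + (vsum p D - vsum p B) = vsum p D"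
        by (rule poly_mapping_eqI) (use le in \<open>simp add: lookup_add lookup_minus\<close>)
      then have "mdeg (vsum p D - vsum p B) = 0"
        using card by (metis add_cancel_right_right mdeg_plus mdeg_vsum)
      with sum False show False by (simp add: mdeg_eq_0)
    qed
    then obtain l where l: "Poly_Mapping.lookup (vsum p B) l < Poly_Mapping.lookup (vsum p D) l"
        "vsum p B - Poly_Mapping.single k 1 + Poly_Mapping.single l 1 \<in> M"
      using M BD unfolding exchange_property_def by blast
    then show ?thesis using label_more_often[OF fin k] label_more_often[OF fin(2,1) l(1)] by metis
  qed
qed

text \<open>Induction on the number of points that the two distributions place differently.\<close>

lemma conn_bins:
  assumes M: "base_orderable M" "exchange_property M" and X: "finite X"
    and "\<forall>x\<in>X. \<beta> x \<in> {0..n}" "\<forall>x\<in>X. \<delta> x \<in> {0..n}"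
    and "\<forall>i\<in>{1..n}. vsum p {x \<in> X. \<beta> x = i} \<in> M" "\<forall>i\<in>{1..n}. vsum p {x \<in> X. \<delta> x = i} \<in> M"
  shows "conn M (bin_config p X n \<beta>) (bin_config p X n \<delta>)"
  using assms(4-7)
proof (induction "card {x \<in> X. \<beta> x \<noteq> \<delta> x}" arbitrary: \<beta> \<delta> rule: less_induct)
  case less
  note range = less.prems(1,2) and inM = less.prems(3,4)
  \<comment> \<open>It suffices that a step preserves all agreements and creates one more.\<close>
  have closer: "card {x \<in> X. \<beta>' x \<noteq> \<delta>' x} < card {x \<in> X. \<beta> x \<noteq> \<delta> x}"
    if "\<And>x. x \<in> X \<Longrightarrow> \<beta> x = \<delta> x \<Longrightarrow> \<beta>' x = \<delta>' x" "\<exists>x\<in>X. \<beta> x \<noteq> \<delta> x \<and> \<beta>' x = \<delta>' x" for \<beta>' \<delta>'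
    using X that by (intro psubset_card_mono) auto
  consider "\<forall>x\<in>X. \<beta> x = \<delta> x"
    | e where "e \<in> X" "\<beta> e \<noteq> \<delta> e" "\<beta> e \<noteq> 0" "\<delta> e \<noteq> 0"
    | e where "e \<in> X" "\<beta> e \<noteq> \<delta> e" "\<forall>x\<in>X. \<beta> x \<noteq> \<delta> x \<longrightarrow> \<beta> x = 0 \<or> \<delta> x = 0" by blast
  then show ?case
  proof cases
    case 1
    then show ?thesis using bin_config_cong[of X \<beta> \<delta> p n] by (simp add: conn_refl)
  next
    case 2
    define i j where "i = \<beta> e" and "j = \<delta> e"
    have ij: "i \<in> {1..n}" "j \<in> {1..n}" "i \<noteq> j" using 2 range by (auto simp: i_def j_def)
    obtain C where C: "vsum p {x \<in> X. \<beta> x \<in> {i, j} \<and> x \<in> C} \<in> M"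
        "vsum p {x \<in> X. \<beta> x \<in> {i, j} \<and> x \<notin> C} \<in> M"
        "vsum p {x \<in> X. \<delta> x \<in> {i, j} \<and> x \<in> C} \<in> M"
        "vsum p {x \<in> X. \<delta> x \<in> {i, j} \<and> x \<notin> C} \<in> M"
      by (rule base_orderable_colour_swap[OF M(1) X, of p \<beta> i j \<delta>]) (use inM ij in auto)
    note \<beta>' = conn_recolour[OF X ij inM(1) C(1,2)] and \<delta>' = conn_recolour[OF X ij inM(2) C(3,4)]
    have "conn M (bin_config p X n (recolour i j C \<beta>)) (bin_config p X n (recolour i j C \<delta>))"
    proof (rule less.hyps[OF closer])
      show "\<exists>x\<in>X. \<beta> x \<noteq> \<delta> x \<and> recolour i j C \<beta> x = recolour i j C \<delta> x"
        using 2 by (intro bexI[of _ e]) (auto simp: recolour_def i_def j_def)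
      show "\<forall>x\<in>X. recolour i j C \<beta> x \<in> {0..n}" "\<forall>x\<in>X. recolour i j C \<delta> x \<in> {0..n}"
        using range ij by (auto simp: recolour_def)
      show "recolour i j C \<beta> x = recolour i j C \<delta> x" if "\<beta> x = \<delta> x" for x
        using that by (simp add: recolour_def)
    qed (fact \<beta>'(2) \<delta>'(2))+
    with \<beta>'(1) \<delta>'(1) show ?thesis by (meson conn_sym conn_trans)
  next
    case 3
    \<comment> \<open>Here one of \<open>\<beta> e\<close> and \<open>\<delta> e\<close> is 0, and
      \<open>i\<close> is the other one. Hence \<open>e\<close> lies in exactly one of the two
      versions of bin \<open>i\<close>, and these differ.\<close>
    define i where "i = (if \<beta> e = 0 then \<delta> e else \<beta> e)"
    have i: "i \<in> {1..n}" using 3 range by (auto simp: i_def)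
    let ?B = "{x \<in> X. \<beta> x = i}" and ?D = "{x \<in> X. \<delta> x = i}"
    have BD: "vsum p ?B \<in> M" "vsum p ?D \<in> M" using inM i by auto
    have "e \<in> ?B \<longleftrightarrow> e \<notin> ?D" using 3 by (auto simp: i_def)
    then have "?B \<noteq> ?D" by blast
    moreover have "finite ?B" "finite ?D" using X by simp_all
    ultimately have "\<exists>x\<in>?B - ?D. \<exists>y\<in>?D - ?B.
        vsum p ?B - Poly_Mapping.single (p x) 1 + Poly_Mapping.single (p y) 1 \<in> M"
      using BD by (intro exchange_towards[OF M(2)])
    then obtain x y where xy: "x \<in> ?B - ?D" "y \<in> ?D - ?B"
      "vsum p ?B - Poly_Mapping.single (p x) 1 + Poly_Mapping.single (p y) 1 \<in> M" by blast
    \<comment> \<open>\<open>x\<close> and \<open>y\<close> are disagreements with bin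
      \<open>i\<close> on one side, so the case assumption leaves only bin 0 for the other side.
      After the exchange both points agree.\<close>
    have zero: "\<delta> x = 0" "\<beta> y = 0" using xy 3(3) i by fastforce+
    let ?\<beta> = "\<beta>(x := 0, y := i)"
    have \<beta>': "conn M (bin_config p X n \<beta>) (bin_config p X n ?\<beta>)"
        "\<forall>k\<in>{1..n}. vsum p {z \<in> X. ?\<beta> z = k} \<in> M"
      using conn_exchange_with_coefficient[OF X i, of x y \<beta> p M] xy zero inM(1) by auto
    have "conn M (bin_config p X n ?\<beta>) (bin_config p X n \<delta>)"
    proof (rule less.hyps[OF closer])
      show "\<exists>z\<in>X. \<beta> z \<noteq> \<delta> z \<and> ?\<beta> z = \<delta> z"
        using xy zero i by (intro bexI[of _ y]) auto
      show "\<forall>x\<in>X. ?\<beta> x \<in> {0..n}" using range i by auto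
      show "?\<beta> z = \<delta> z" if "z \<in> X" "\<beta> z = \<delta> z" for z using that xy zero by auto
    qed (fact range(2) \<beta>'(2) inM(2))+
    with \<beta>'(1) show ?thesis by (rule conn_trans)
  qed
qed

text \<open>Both pairs factor the same monomial, so \<open>vsum_distribute\<close> turns them into
  two distributions of one common set of points, to which \<open>conn_bins\<close> applies.\<close>

lemma linked_if_base_orderable:
  assumes "base_orderable M" "exchange_property M"
  shows "linked M"
  unfolding linked_def
proof (intro allI impI)
  fix a b :: "'a expo" and U V
  assume U: "set_mset U \<subseteq> M" and V: "set_mset V \<subseteq> M" and size: "size U = size V"
    and eq: "a + \<Sum>\<^sub># U = b + \<Sum>\<^sub># V"
  define n where "n = size U"
  obtain P where P: "a + \<Sum>\<^sub># U = (\<Sum>i\<in>#P. Poly_Mapping.single i 1)" by (rule expo_as_sum_mset)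
  obtain ps where ps: "mset ps = P" using ex_mset by blast
  define p where "p x = ps ! x" for x
  \<comment> \<open>Points are the positions in a list of the variables of the common monomial, so a
    variable of multiplicity k is carried by k points.\<close>
  define X where "X = {..<length ps}"
  have "vsum p X = sum_list (map (\<lambda>i. Poly_Mapping.single i 1) ps)"
    by (simp add: vsum_def p_def X_def sum_list_sum_nth atLeast0LessThan)
  then have X: "finite X" "vsum p X = a + \<Sum>\<^sub># U"
    by (simp_all add: X_def P flip: ps sum_mset_sum_list)
  have ex: "\<exists>\<beta>. (\<forall>x\<in>X. \<beta> x \<in> {0..n}) \<and> (\<forall>i\<in>{1..n}. vsum p {x \<in> X. \<beta> x = i} \<in> M) \<and>
      bin_config p X n \<beta> = (c, W)"
    if W: "set_mset W \<subseteq> M" "size W = n" "vsum p X = c + \<Sum>\<^sub># W" for c W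
  proof -
    obtain ws where ws: "mset ws = W" using ex_mset by blast
    with W have len: "length ws = n" by auto
    \<comment> \<open>The shift by one reserves index 0 for the coefficient exponent
      \<open>c\<close>; the generators have indices 1 to \<open>n\<close>.\<close>
    define g where "g i = (c # ws) ! i" for i
    have mset: "image_mset g (mset_set {1..n}) = W"
    proof -
      have "mset (map g [1..<Suc n]) = mset ws"
        using len by (intro arg_cong[of _ _ mset] nth_equalityI) (auto simp: g_def simp del: upt_Suc)
      then show ?thesis
        unfolding ws mset_map mset_upt by (simp add: atLeastLessThanSuc_atLeastAtMost)
    qed
    have "{0..n} = insert 0 {1..n}" by auto
    then have "(\<Sum>i\<in>{0..n}. g i) = g 0 + (\<Sum>i\<in>{1..n}. g i)" by simp
    also have "(\<Sum>i\<in>{1..n}. g i) = \<Sum>\<^sub># W" unfolding sum_unfold_sum_mset mset ..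
    finally have "vsum p X = (\<Sum>i\<in>{0..n}. g i)" using W by (simp add: g_def)
    then obtain \<beta> where \<beta>: "\<forall>x\<in>X. \<beta> x \<in> {0..n}" "\<forall>i\<in>{0..n}. vsum p {x \<in> X. \<beta> x = i} = g i"
      using vsum_distribute[of "{0..n}" X p g] X by auto
    have "g i \<in> M" if "i \<in> {1..n}" for i
      using that W(1) len by (auto simp: g_def nth_Cons' ws[symmetric])
    moreover have "bin_config p X n \<beta> = (g 0, image_mset g (mset_set {1..n}))"
      unfolding bin_config_def using \<beta>(2) by (auto intro!: image_mset_cong)
    ultimately show ?thesis using \<beta> mset by (intro exI[of _ \<beta>]) (auto simp: g_def)
  qed
  obtain \<beta> where \<beta>: "\<forall>x\<in>X. \<beta> x \<in> {0..n}" "\<forall>i\<in>{1..n}. vsum p {x \<in> X. \<beta> x = i} \<in> M"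
      "bin_config p X n \<beta> = (a, U)"
    using ex[of U a] U X by (auto simp: n_def)
  obtain \<delta> where \<delta>: "\<forall>x\<in>X. \<delta> x \<in> {0..n}" "\<forall>i\<in>{1..n}. vsum p {x \<in> X. \<delta> x = i} \<in> M"
      "bin_config p X n \<delta> = (b, V)"
    using ex[of V b] V X eq size by (auto simp: n_def)
  show "conn M (a, U) (b, V)"
    using conn_bins[OF assms X(1) \<beta>(1) \<delta>(1) \<beta>(2) \<delta>(2)] unfolding \<beta>(3) \<delta>(3) .
qed

section \<open>Strong exchange and transversal bases\<close>

lemma sum_lookup_mdeg:
  fixes a :: "'x::finite expo"
  shows "mdeg a = (\<Sum>i\<in>UNIV. Poly_Mapping.lookup a i)"
  by (rule mdeg_sum) auto

definition expo_between :: "'x expo \<Rightarrow> 'x expo \<Rightarrow> 'x expo \<Rightarrow> bool" where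
  "expo_between u v w \<longleftrightarrow> (\<forall>k.
     min (Poly_Mapping.lookup u k) (Poly_Mapping.lookup v k) \<le> Poly_Mapping.lookup w k \<and>
     Poly_Mapping.lookup w k \<le> max (Poly_Mapping.lookup u k) (Poly_Mapping.lookup v k))"

text \<open>\<open>u\<close> walks to \<open>w\<close> by exchanges against \<open>v\<close>. Where
  \<open>u\<close> exceeds \<open>w\<close> it also exceeds \<open>v\<close>, because
  \<open>w\<close> lies between them, and likewise where it falls short; so strong exchange allows
  the step. The step stays within range and lowers the total excess of \<open>u\<close> over
  \<open>w\<close>.\<close>

lemma strong_exchange_between:
  fixes M :: "'x::finite expo set"
  assumes strong: "\<And>a b i j. a \<in> M \<Longrightarrow> b \<in> M \<Longrightarrow> Poly_Mapping.lookup b i < Poly_Mapping.lookup a i \<Longrightarrow>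
      Poly_Mapping.lookup a j < Poly_Mapping.lookup b j \<Longrightarrow>
      a - Poly_Mapping.single i 1 + Poly_Mapping.single j 1 \<in> M"
    and "u \<in> M" "v \<in> M" "mdeg w = mdeg u"
    and "expo_between u v w"
  shows "w \<in> M"
  using assms(2-)
proof (induction "\<Sum>i\<in>UNIV. Poly_Mapping.lookup u i - Poly_Mapping.lookup w i" arbitrary: u rule: less_induct)
  case less
  let ?u = "Poly_Mapping.lookup u" and ?v = "Poly_Mapping.lookup v" and ?w = "Poly_Mapping.lookup w"
  show ?case
  proof (cases "u = w")
    case False
    have sums: "(\<Sum>i\<in>UNIV. ?w i) = (\<Sum>i\<in>UNIV. ?u i)"
      using less.prems(3) by (simp add: sum_lookup_mdeg)
    from False obtain k where k: "?u k \<noteq> ?w k" by (metis poly_mapping_eqI)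
    \<comment> \<open>Since the degrees agree, \<open>u \<noteq> w\<close> forces both a coordinate
      of excess and one of deficit.\<close>
    have "\<exists>i. ?w i < ?u i"
    proof (rule ccontr)
      assume "\<not> ?thesis"
      then have le: "?u i \<le> ?w i" for i by (meson not_less)
      with k have "?u k < ?w k" by (metis nat_less_le)
      with le have "(\<Sum>i\<in>UNIV. ?u i) < (\<Sum>i\<in>UNIV. ?w i)"
        by (intro sum_strict_mono_ex1) auto
      with sums show False by simp
    qed
    then obtain i where i: "?w i < ?u i" by blast
    have "\<exists>j. ?u j < ?w j"
    proof (rule ccontr)
      assume "\<not> ?thesis"
      then have le: "?w i \<le> ?u i" for i by (meson not_less)
      with i have "(\<Sum>i\<in>UNIV. ?w i) < (\<Sum>i\<in>UNIV. ?u i)"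
        by (intro sum_strict_mono_ex1) auto
      with sums show False by simp
    qed
    then obtain j where j: "?u j < ?w j" by blast
    define u' where "u' = u - Poly_Mapping.single i 1 + Poly_Mapping.single j 1"
    have "i \<noteq> j" using i j by auto
    then have u': "Poly_Mapping.lookup u' k = (if k = i then ?u i - 1 else if k = j then ?u j + 1 else ?u k)" for k
      by (auto simp: u'_def lookup_add lookup_minus lookup_single when_def)
    note between = less.prems(4)[unfolded expo_between_def, rule_format]
    have vi: "?v i < ?u i" "?v i \<le> ?w i" using i between[of i] by auto
    have vj: "?u j < ?v j" "?w j \<le> ?v j" using j between[of j] by auto
    have "u' \<in> M" unfolding u'_def using less.prems(1,2) vi(1) vj(1) by (rule strong)
    have "u - Poly_Mapping.single i 1 + Poly_Mapping.single i 1 = u"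
      using i by (intro minus_single_add) auto
    then have "mdeg u' = mdeg u"
      unfolding u'_def by (metis mdeg_plus mdeg_single)
    show ?thesis
    proof (rule less.hyps)
      show "(\<Sum>k\<in>UNIV. Poly_Mapping.lookup u' k - ?w k) < (\<Sum>k\<in>UNIV. ?u k - ?w k)"
        using i j \<open>i \<noteq> j\<close> by (intro sum_strict_mono_ex1) (auto simp: u' intro!: exI[of _ i])
      show "u' \<in> M" "v \<in> M" by fact+
      show "mdeg w = mdeg u'" using \<open>mdeg u' = mdeg u\<close> less.prems(3) by simp
      show "expo_between u' v w"
        unfolding expo_between_def
      proof
        fix k
        show "min (Poly_Mapping.lookup u' k) (?v k) \<le> ?w k \<and> ?w k \<le> max (Poly_Mapping.lookup u' k) (?v k)"
          using between[of k] i j vi vj by (auto simp: u')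
      qed
    qed
  qed (use less.prems in simp)
qed

text \<open>Points with equal labels are paired first: such a pair contributes the same variable
  once to all three sums. When no label is common to \<open>X\<close> and \<open>Y\<close> any
  pairing will do, because at each variable one of the two sums vanishes and \<open>S\<close> cannot
  exceed the other.\<close>

lemma pairing_splits_between:
  fixes p :: "'a \<Rightarrow> 'x"
  assumes "finite X" "finite Y" "X \<inter> Y = {}" "card X = card Y"
  shows "\<exists>\<sigma>. bij_betw \<sigma> X Y \<and> (\<forall>S\<subseteq>X \<union> Y. splits_pairing X \<sigma> S \<longrightarrow>
    expo_between (vsum p X) (vsum p Y) (vsum p S))"
  using assms
proof (induction "card X" arbitrary: X Y rule: less_induct)
  case less
  show ?case
  proof (cases "\<exists>x\<in>X. \<exists>y\<in>Y. p x = p y")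
    case True
    then obtain x y where xy: "x \<in> X" "y \<in> Y" "p x = p y" by blast
    let ?X = "X - {x}" and ?Y = "Y - {y}"
    have "card ?X < card X" using less.prems(1) xy(1) by (rule card_Diff1_less)
    moreover have "card ?X = card ?Y" "?X \<inter> ?Y = {}" using less.prems xy by auto
    ultimately obtain \<sigma> where \<sigma>: "bij_betw \<sigma> ?X ?Y"
      and between: "\<And>S. S \<subseteq> ?X \<union> ?Y \<Longrightarrow> splits_pairing ?X \<sigma> S \<Longrightarrow>
        expo_between (vsum p ?X) (vsum p ?Y) (vsum p S)"
      using less.hyps[of ?X ?Y] less.prems(1,2) by (metis finite_Diff)
    let ?\<sigma> = "\<sigma>(x := y)"
    have im: "\<sigma> z \<in> ?Y" if "z \<in> ?X" for z using \<sigma> that by (auto simp: bij_betw_def)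
    have "bij_betw ?\<sigma> X Y"
    proof -
      have "bij_betw ?\<sigma> ?X ?Y" using \<sigma> by (rule bij_betw_cong[THEN iffD1, rotated]) auto
      moreover have "bij_betw ?\<sigma> {x} {y}" by (simp add: bij_betw_def)
      ultimately have "bij_betw ?\<sigma> (?X \<union> {x}) (?Y \<union> {y})" by (rule bij_betw_combine) auto
      then show ?thesis using xy by (simp add: insert_absorb)
    qed
    moreover have "expo_between (vsum p X) (vsum p Y) (vsum p S)"
      if S: "S \<subseteq> X \<union> Y" "splits_pairing X ?\<sigma> S" for S
    proof -
      define S' where "S' = S - {x, y}"
      have "S' \<subseteq> ?X \<union> ?Y" using S(1) unfolding S'_def by blast
      moreover have "splits_pairing ?X \<sigma> S'"
        unfolding splits_pairing_def
      proof
        fix z assume z: "z \<in> ?X"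
        then have "\<sigma> z \<in> S \<longleftrightarrow> z \<notin> S"
          using S(2)[unfolded splits_pairing_def, rule_format, of z] by simp
        moreover have "\<sigma> z \<notin> {x, y}" "z \<notin> {x, y}" using im[OF z] z xy less.prems(3) by auto
        ultimately show "\<sigma> z \<in> S' \<longleftrightarrow> z \<notin> S'" by (auto simp: S'_def)
      qed
      ultimately have b: "expo_between (vsum p ?X) (vsum p ?Y) (vsum p S')" by (rule between)
      have "finite S" using S(1) less.prems(1,2) by (meson finite_UnI finite_subset)
      then have fin: "finite S'" "finite ?X" "finite ?Y"
        using less.prems(1,2) by (simp_all add: S'_def)
      have notin: "x \<notin> S'" "y \<notin> S'" by (simp_all add: S'_def)
      \<comment> \<open>\<open>S\<close> takes one of \<open>x\<close> and \<open>y\<close>; their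
        labels are equal, so either choice adds the same unit vector.\<close>
      have "y \<in> S \<longleftrightarrow> x \<notin> S" using S(2)[unfolded splits_pairing_def, rule_format, OF xy(1)] by simp
      then have "S = insert x S' \<or> S = insert y S'" unfolding S'_def by blast
      then have "vsum p S = Poly_Mapping.single (p x) 1 + vsum p S'"
        using vsum_insert[OF fin(1) notin(1), of p] vsum_insert[OF fin(1) notin(2), of p] xy(3)
        by metis
      moreover have "vsum p X = Poly_Mapping.single (p x) 1 + vsum p ?X"
        using vsum_insert[OF fin(2), of x p] xy(1) by (simp add: insert_absorb)
      moreover have "vsum p Y = Poly_Mapping.single (p x) 1 + vsum p ?Y"
        using vsum_insert[OF fin(3), of y p] xy(2,3) by (simp add: insert_absorb)
      ultimately show ?thesis
        using b by (simp add: expo_between_def lookup_add min_le_iff_disj le_max_iff_disj)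
    qed
    ultimately show ?thesis by blast
  next
    case False
    obtain \<sigma> where \<sigma>: "bij_betw \<sigma> X Y"
      using less.prems finite_same_card_bij by blast
    have "min (Poly_Mapping.lookup (vsum p X) k) (Poly_Mapping.lookup (vsum p Y) k) = 0 \<and>
       Poly_Mapping.lookup (vsum p S) k
           \<le> max (Poly_Mapping.lookup (vsum p X) k) (Poly_Mapping.lookup (vsum p Y) k)"
      if "S \<subseteq> X \<union> Y" for S k
    proof -
      have fin: "finite S" using that less.prems finite_subset by blast
      have "(\<forall>x\<in>X. p x \<noteq> k) \<or> (\<forall>x\<in>Y. p x \<noteq> k)" using False by metis
      then show ?thesis
      proof
        assume no: "\<forall>x\<in>X. p x \<noteq> k"
        with that have "{x \<in> S. p x = k} \<subseteq> {x \<in> Y. p x = k}" by blast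
        moreover have "finite {x \<in> Y. p x = k}" using less.prems(2) by simp
        ultimately have le: "card {x \<in> S. p x = k} \<le> card {x \<in> Y. p x = k}" by (rule card_mono[rotated])
        have "{x \<in> X. p x = k} = {}" using no by blast
        then have zero: "card {x \<in> X. p x = k} = 0" by (simp only: card.empty)
        show ?thesis
          unfolding lookup_vsum[OF fin] lookup_vsum[OF less.prems(1)] lookup_vsum[OF less.prems(2)]
          using le zero by linarith
      next
        assume no: "\<forall>x\<in>Y. p x \<noteq> k"
        with that have "{x \<in> S. p x = k} \<subseteq> {x \<in> X. p x = k}" by blast
        moreover have "finite {x \<in> X. p x = k}" using less.prems(1) by simp
        ultimately have le: "card {x \<in> S. p x = k} \<le> card {x \<in> X. p x = k}" by (rule card_mono[rotated])
        have "{x \<in> Y. p x = k} = {}" using no by blast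
        then have zero: "card {x \<in> Y. p x = k} = 0" by (simp only: card.empty)
        show ?thesis
          unfolding lookup_vsum[OF fin] lookup_vsum[OF less.prems(1)] lookup_vsum[OF less.prems(2)]
          using le zero by linarith
      qed
    qed
    then have "expo_between (vsum p X) (vsum p Y) (vsum p S)" if "S \<subseteq> X \<union> Y" for S
      using that by (simp add: expo_between_def)
    with \<sigma> show ?thesis by blast
  qed
qed

text \<open>\<open>\<sigma>\<close> maps the points of \<open>X\<close> missed by \<open>S\<close>
  bijectively onto the points of \<open>Y\<close> in \<open>S\<close>.\<close>

lemma splits_pairing_card:
  assumes "finite X" "finite Y" "X \<inter> Y = {}" "bij_betw \<sigma> X Y" "S \<subseteq> X \<union> Y" "splits_pairing X \<sigma> S"
  shows "card S = card X"
proof -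
  have "\<sigma> ` (X - S) = S \<inter> Y"
  proof
    show "\<sigma> ` (X - S) \<subseteq> S \<inter> Y" using assms(4,6) by (auto simp: splits_pairing_def bij_betw_def)
    show "S \<inter> Y \<subseteq> \<sigma> ` (X - S)"
    proof
      fix y assume y: "y \<in> S \<inter> Y"
      then obtain x where "x \<in> X" "y = \<sigma> x" using assms(4) by (auto simp: bij_betw_def)
      with y assms(6) show "y \<in> \<sigma> ` (X - S)" by (auto simp: splits_pairing_def)
    qed
  qed
  moreover have "inj_on \<sigma> (X - S)" using assms(4) by (auto simp: bij_betw_def inj_on_diff)
  ultimately have "card (S \<inter> Y) = card (X - S)" by (metis card_image)
  moreover have "card (S \<inter> X) + card (S \<inter> Y) = card S"
    using assms by (subst card_Un_disjoint[symmetric]) (auto intro!: arg_cong[of _ _ card] finite_subset[OF assms(5)])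
  moreover have "card (S \<inter> X) + card (X - S) = card X"
    using assms(1) by (metis Int_commute card_Int_Diff add.commute card_Diff_subset_Int)
  ultimately show ?thesis by simp
qed

text \<open>Under the pairing from \<open>pairing_splits_between\<close>, each splitting set has an
  exponent vector of the right degree between the two bases, and strong exchange puts all such
  vectors into \<open>M\<close>.\<close>

lemma base_orderable_strong_exchange:
  fixes M :: "'x::finite expo set"
  assumes "\<And>a b. a \<in> M \<Longrightarrow> b \<in> M \<Longrightarrow> mdeg a = mdeg b"
    and "\<And>a b i j. a \<in> M \<Longrightarrow> b \<in> M \<Longrightarrow> Poly_Mapping.lookup b i < Poly_Mapping.lookup a i \<Longrightarrow>
      Poly_Mapping.lookup a j < Poly_Mapping.lookup b j \<Longrightarrow>
      a - Poly_Mapping.single i 1 + Poly_Mapping.single j 1 \<in> M"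
  shows "base_orderable M"
  unfolding base_orderable_def
proof (intro allI impI)
  fix p :: "nat \<Rightarrow> 'x" and X Y
  assume fin: "finite X" "finite Y" and dis: "X \<inter> Y = {}" and M: "vsum p X \<in> M" "vsum p Y \<in> M"
  have "card X = card Y" using assms(1)[OF M] by (simp add: mdeg_vsum)
  from pairing_splits_between[OF fin dis this, of p] obtain \<sigma> where \<sigma>: "bij_betw \<sigma> X Y"
    and between: "\<And>S. S \<subseteq> X \<union> Y \<Longrightarrow> splits_pairing X \<sigma> S \<Longrightarrow>
      expo_between (vsum p X) (vsum p Y) (vsum p S)"
    by blast
  have "vsum p S \<in> M" if S: "S \<subseteq> X \<union> Y" "splits_pairing X \<sigma> S" for S
  proof (rule strong_exchange_between[OF assms(2) M _ between[OF S]])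
    show "mdeg (vsum p S) = mdeg (vsum p X)"
      using splits_pairing_card[OF fin dis \<sigma> S] by (simp add: mdeg_vsum)
  qed
  with \<sigma> show "\<exists>\<sigma>. bij_betw \<sigma> X Y \<and> (\<forall>S\<subseteq>X \<union> Y. splits_pairing X \<sigma> S \<longrightarrow> vsum p S \<in> M)"
    by blast
qed

section \<open>Transversal polymatroids: bases as choices of one variable from each set\<close>

definition choice_sums :: "'x set list \<Rightarrow> 'x expo set" where
  "choice_sums Vs = {\<Sum>k<length Vs. Poly_Mapping.single (c k) 1 | c. \<forall>k<length Vs. c k \<in> Vs ! k}"

lemma choice_sums_Nil: "choice_sums [] = {0}"
  by (auto simp: choice_sums_def)

lemma choice_sums_Cons:
  "choice_sums (V # Vs) = {Poly_Mapping.single v 1 + b | v b. v \<in> V \<and> b \<in> choice_sums Vs}"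
proof (intro equalityI subsetI)
  fix a assume "a \<in> choice_sums (V # Vs)"
  then obtain c where c: "a = (\<Sum>k<Suc (length Vs). Poly_Mapping.single (c k) 1)"
    "\<forall>k<Suc (length Vs). c k \<in> (V # Vs) ! k" by (auto simp: choice_sums_def)
  have "a = Poly_Mapping.single (c 0) 1 + (\<Sum>k<length Vs. Poly_Mapping.single (c (Suc k)) 1)"
    unfolding c(1) by (rule sum.lessThan_Suc_shift)
  moreover have "c 0 \<in> V" using c(2) by force
  moreover have "(\<Sum>k<length Vs. Poly_Mapping.single (c (Suc k)) 1) \<in> choice_sums Vs"
    unfolding choice_sums_def using c(2) by (intro CollectI exI[of _ "\<lambda>k. c (Suc k)"]) auto
  ultimately show "a \<in> {Poly_Mapping.single v 1 + b | v b. v \<in> V \<and> b \<in> choice_sums Vs}" by blast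
next
  fix a assume "a \<in> {Poly_Mapping.single v 1 + b | v b. v \<in> V \<and> b \<in> choice_sums Vs}"
  then obtain v c where c: "v \<in> V" "\<forall>k<length Vs. c k \<in> Vs ! k"
    "a = Poly_Mapping.single v 1 + (\<Sum>k<length Vs. Poly_Mapping.single (c k) 1)"
    by (auto simp: choice_sums_def)
  have "a = (\<Sum>k<Suc (length Vs). Poly_Mapping.single (case_nat v c k) 1)"
    unfolding c(3) by (subst sum.lessThan_Suc_shift) simp
  moreover have "\<forall>k<Suc (length Vs). case_nat v c k \<in> (V # Vs) ! k"
    using c by (auto simp: less_Suc_eq_0_disj)
  ultimately show "a \<in> choice_sums (V # Vs)" unfolding choice_sums_def by auto
qed

lemma mdeg_choice_sums: "a \<in> choice_sums Vs \<Longrightarrow> mdeg a = length Vs"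
proof (induction Vs arbitrary: a)
  case Nil
  then show ?case by (simp add: choice_sums_Nil mdeg_eq_0)
next
  case (Cons V Vs)
  then show ?case using mdeg_single by (auto simp: choice_sums_Cons mdeg_plus)
qed

text \<open>Each summand of a choice is a single variable, so distributing the points over the
  summands puts exactly one point at each list position. Conversely, the inverse of the matching
  \<open>\<beta>\<close> reads off a choice.\<close>

lemma vsum_in_choice_sums:
  assumes "finite X"
  shows "vsum p X \<in> choice_sums Vs \<longleftrightarrow>
    (\<exists>\<beta>. bij_betw \<beta> X {..<length Vs} \<and> (\<forall>x\<in>X. p x \<in> Vs ! \<beta> x))"
proof
  assume "vsum p X \<in> choice_sums Vs"
  then obtain c where c: "vsum p X = (\<Sum>k<length Vs. Poly_Mapping.single (c k) 1)"
    "\<forall>k<length Vs. c k \<in> Vs ! k" by (auto simp: choice_sums_def)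
  from vsum_distribute[OF _ assms c(1)] obtain \<beta> where \<beta>: "\<forall>x\<in>X. \<beta> x < length Vs"
    "\<And>k. k < length Vs \<Longrightarrow> vsum p {x \<in> X. \<beta> x = k} = Poly_Mapping.single (c k) 1" by auto
  have single: "\<exists>x. {x \<in> X. \<beta> x = k} = {x}" if "k < length Vs" for k
  proof -
    have "card {x \<in> X. \<beta> x = k} = 1"
      using \<beta>(2)[OF that] mdeg_vsum[of p "{x \<in> X. \<beta> x = k}"] mdeg_single by metis
    then show ?thesis by (rule card_1_singletonE) blast
  qed
  have "bij_betw \<beta> X {..<length Vs}"
  proof (rule bij_betwI')
    show "\<beta> x = \<beta> y \<longleftrightarrow> x = y" if "x \<in> X" "y \<in> X" for x y
    proof
      assume "\<beta> x = \<beta> y"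
      with that have "x \<in> {z \<in> X. \<beta> z = \<beta> x}" "y \<in> {z \<in> X. \<beta> z = \<beta> x}" by auto
      then show "x = y" using single[of "\<beta> x"] \<beta>(1) that(1) by (metis singletonD)
    qed simp
    show "\<exists>x\<in>X. k = \<beta> x" if "k \<in> {..<length Vs}" for k
      using single[of k] that by auto
  qed (use \<beta>(1) in auto)
  moreover have "p x \<in> Vs ! \<beta> x" if x: "x \<in> X" for x
  proof -
    have b: "\<beta> x < length Vs" using \<beta>(1) x by blast
    obtain z where z: "{y \<in> X. \<beta> y = \<beta> x} = {z}" using single[OF b] by blast
    moreover have "x \<in> {y \<in> X. \<beta> y = \<beta> x}" using x by simp
    ultimately have "{y \<in> X. \<beta> y = \<beta> x} = {x}" by (metis singletonD)
    with \<beta>(2)[OF b] have "Poly_Mapping.single (p x) 1 = Poly_Mapping.single (c (\<beta> x)) (1::nat)"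
      by (simp add: vsum_def)
    then have "p x = c (\<beta> x)" by (metis keys_single singleton_inject zero_neq_one)
    with b c(2) show ?thesis by simp
  qed
  ultimately show "\<exists>\<beta>. bij_betw \<beta> X {..<length Vs} \<and> (\<forall>x\<in>X. p x \<in> Vs ! \<beta> x)" by blast
next
  assume "\<exists>\<beta>. bij_betw \<beta> X {..<length Vs} \<and> (\<forall>x\<in>X. p x \<in> Vs ! \<beta> x)"
  then obtain \<beta> where \<beta>: "bij_betw \<beta> X {..<length Vs}" "\<forall>x\<in>X. p x \<in> Vs ! \<beta> x" by blast
  let ?c = "\<lambda>k. p (inv_into X \<beta> k)"
  have inv: "bij_betw (inv_into X \<beta>) {..<length Vs} X" using \<beta>(1) by (rule bij_betw_inv_into)
  have "vsum p X = (\<Sum>k<length Vs. Poly_Mapping.single (?c k) 1)"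
    unfolding vsum_def by (rule sum.reindex_bij_betw[OF inv, symmetric])
  moreover have "?c k \<in> Vs ! k" if "k < length Vs" for k
    using \<beta> that by (metis bij_betw_inv_into_right bij_betw_apply inv lessThan_iff)
  ultimately show "vsum p X \<in> choice_sums Vs"
    unfolding choice_sums_def by (intro CollectI exI[of _ ?c]) simp
qed

text \<open>Points of \<open>X\<close> and \<open>Y\<close> matched to the same list position are
  paired. A set with exactly one point of each pair then still occupies every position exactly
  once.\<close>

lemma base_orderable_choice_sums: "base_orderable (choice_sums Vs)"
  unfolding base_orderable_def
proof (intro allI impI)
  fix p :: "nat \<Rightarrow> 'a" and X Y
  assume fin: "finite X" "finite Y" and dis: "X \<inter> Y = {}"
    and "vsum p X \<in> choice_sums Vs" "vsum p Y \<in> choice_sums Vs"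
  then obtain \<beta> \<gamma> where \<beta>: "bij_betw \<beta> X {..<length Vs}" "\<forall>x\<in>X. p x \<in> Vs ! \<beta> x"
    and \<gamma>: "bij_betw \<gamma> Y {..<length Vs}" "\<forall>x\<in>Y. p x \<in> Vs ! \<gamma> x"
    by (auto simp: vsum_in_choice_sums)
  define \<sigma> where "\<sigma> = inv_into Y \<gamma> \<circ> \<beta>"
  have \<sigma>: "bij_betw \<sigma> X Y"
    unfolding \<sigma>_def using \<beta>(1) bij_betw_inv_into[OF \<gamma>(1)] by (rule bij_betw_trans)
  have \<gamma>\<sigma>: "\<gamma> (\<sigma> x) = \<beta> x" if "x \<in> X" for x
    using that \<beta>(1) \<gamma>(1) by (auto simp: \<sigma>_def bij_betw_def intro!: f_inv_into_f)
  have "vsum p S \<in> choice_sums Vs" if S: "S \<subseteq> X \<union> Y" "splits_pairing X \<sigma> S" for S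
  proof -
    have finS: "finite S" using S(1) fin finite_subset by blast
    define \<epsilon> where "\<epsilon> x = (if x \<in> X then \<beta> x else \<gamma> x)" for x
    have on_Y: "\<epsilon> y = \<gamma> y" if "y \<in> Y" for y using that dis by (auto simp: \<epsilon>_def)
    have surj: "\<epsilon> ` S = {..<length Vs}"
    proof
      have "\<epsilon> x \<in> {..<length Vs}" if "x \<in> S" for x
        using that S(1) bij_betw_apply[OF \<beta>(1), of x] bij_betw_apply[OF \<gamma>(1), of x]
        by (auto simp: \<epsilon>_def)
      then show "\<epsilon> ` S \<subseteq> {..<length Vs}" by blast
      show "{..<length Vs} \<subseteq> \<epsilon> ` S"
      proof
        fix k assume "k \<in> {..<length Vs}"
        then obtain x where x: "x \<in> X" "\<beta> x = k"
          using bij_betw_imp_surj_on[OF \<beta>(1)] by (metis imageE)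
        show "k \<in> \<epsilon> ` S"
        proof (cases "x \<in> S")
          case True
          then show ?thesis using x by (auto simp: \<epsilon>_def)
        next
          case False
          then have "\<sigma> x \<in> S" using S(2) x by (auto simp: splits_pairing_def)
          moreover have "\<epsilon> (\<sigma> x) = k"
            using on_Y[of "\<sigma> x"] \<gamma>\<sigma>[OF x(1)] x \<sigma> by (auto simp: bij_betw_def)
          ultimately show ?thesis by blast
        qed
      qed
    qed
    have "card S = card {..<length Vs}"
      using splits_pairing_card[OF fin dis \<sigma> S] bij_betw_same_card[OF \<beta>(1)] by simp
    then have "bij_betw \<epsilon> S {..<length Vs}"
      using surj finS by (auto simp: bij_betw_def intro: eq_card_imp_inj_on)
    moreover have "\<forall>x\<in>S. p x \<in> Vs ! \<epsilon> x"
      using S(1) \<beta>(2) \<gamma>(2) by (auto simp: \<epsilon>_def)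
    ultimately show ?thesis using vsum_in_choice_sums[OF finS] by blast
  qed
  with \<sigma> show "\<exists>\<sigma>. bij_betw \<sigma> X Y \<and> (\<forall>S\<subseteq>X \<union> Y. splits_pairing X \<sigma> S \<longrightarrow> vsum p S \<in> choice_sums Vs)"
    by blast
qed

section \<open>Ferrers graphs\<close>

lemma lookup_sum_mset_pos:
  assumes "Poly_Mapping.lookup (b + \<Sum>\<^sub># V) z > (0::nat)"
  shows "Poly_Mapping.lookup b z > 0 \<or> (\<exists>f\<in>#V. Poly_Mapping.lookup f z > 0)"
  using assms by (induction V) (auto simp: lookup_add)

lemma expo_split_single:
  assumes "Poly_Mapping.lookup a z > (0::nat)"
  obtains a' where "a = a' + Poly_Mapping.single z 1"
  using minus_single_add[OF assms] by metis

lemma mset_split_member: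
  assumes "f \<in># V"
  obtains V' where "V = V' + {#f#}"
  using assms by (metis add_mset_add_single insert_DiffM)

definition edge_gen :: "'v \<Rightarrow> 'v \<Rightarrow> 'v expo" where
  "edge_gen u v = Poly_Mapping.single u 1 + Poly_Mapping.single v 1"

text \<open>Injectivity and disjointness are asked only at indices that carry an edge:
  \<open>X\<close> and \<open>Y\<close> will be list lookups, whose values beyond the length are
  unspecified.\<close>

locale ferrers_pattern =
  fixes X Y :: "nat \<Rightarrow> 'v" and R :: "nat \<Rightarrow> nat \<Rightarrow> bool"
  assumes down: "R i j \<Longrightarrow> r \<le> i \<Longrightarrow> s \<le> j \<Longrightarrow> R r s"
    and X_inj: "R i j \<Longrightarrow> R i' j' \<Longrightarrow> X i = X i' \<Longrightarrow> i = i'"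
    and Y_inj: "R i j \<Longrightarrow> R i' j' \<Longrightarrow> Y j = Y j' \<Longrightarrow> j = j'"
    and X_Y: "R i j \<Longrightarrow> R i' j' \<Longrightarrow> X i \<noteq> Y j'"
begin

abbreviation g :: "nat \<Rightarrow> nat \<Rightarrow> 'v expo" where
  "g i j \<equiv> edge_gen (X i) (Y j)"

definition gens :: "'v expo set" where
  "gens = {g i j |i j. R i j}"

lemma g_in_gens: "R i j \<Longrightarrow> g i j \<in> gens"
  by (auto simp: gens_def)

lemma some_edge:
  assumes "set_mset V \<subseteq> gens" "V \<noteq> {#}"
  obtains i j where "R i j" "g i j \<in># V"
proof -
  from assms(2) obtain f where "f \<in># V" by blast
  moreover from this have "f \<in> gens" using assms(1) by blast
  ultimately show thesis using that by (auto simp: gens_def)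
qed

lemma lookup_g_X:
  assumes "R i j" "R r s" "Poly_Mapping.lookup (g i j) (X r) > 0"
  shows "i = r"
  using assms X_inj[OF assms(1,2)] X_Y[OF assms(2,1)]
  by (auto simp: edge_gen_def lookup_add lookup_single when_def split: if_splits)

lemma lookup_g_Y:
  assumes "R i j" "R r s" "Poly_Mapping.lookup (g i j) (Y s) > 0"
  shows "j = s"
  using assms Y_inj[OF assms(1,2)] X_Y[OF assms(1,2)]
  by (auto simp: edge_gen_def lookup_add lookup_single when_def split: if_splits)

text \<open>The variables occurring in an edge monomial determine its two indices.\<close>

lemma inj_g: "inj_on (\<lambda>(i, j). g i j) {(i, j). R i j}"
proof -
  have "i = i' \<and> j = j'" if "R i j" "R i' j'" "g i j = g i' j'" for i j i' j'
  proof -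
    have "Poly_Mapping.lookup (g i j) (X i') > 0" "Poly_Mapping.lookup (g i j) (Y j') > 0"
      unfolding that(3) by (simp_all add: edge_gen_def lookup_add)
    then show ?thesis using that(1,2) lookup_g_X lookup_g_Y by blast
  qed
  then show ?thesis by (auto simp: inj_on_def)
qed

lemma conn_change_X:
  assumes "R i j" "R r j" "set_mset V \<subseteq> gens"
  shows "conn gens (b + Poly_Mapping.single (X r) 1, V + {#g i j#})
    (b + Poly_Mapping.single (X i) 1, V + {#g r j#})"
proof (rule conn_lin)
  show "Poly_Mapping.single (X r) 1 + g i j = Poly_Mapping.single (X i) 1 + g r j"
    by (simp add: edge_gen_def ac_simps)
qed (use assms g_in_gens in auto)

lemma conn_change_Y:
  assumes "R i j" "R i s" "set_mset V \<subseteq> gens"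
  shows "conn gens (b + Poly_Mapping.single (Y s) 1, V + {#g i j#})
    (b + Poly_Mapping.single (Y j) 1, V + {#g i s#})"
proof (rule conn_lin)
  show "Poly_Mapping.single (Y s) 1 + g i j = Poly_Mapping.single (Y j) 1 + g i s"
    by (simp add: edge_gen_def ac_simps)
qed (use assms g_in_gens in auto)

text \<open>The variables \<open>X r\<close> and \<open>Y j\<close> each come from \<open>b\<close>
  or from an edge in \<open>V\<close>; the moves bring them together. Edges of \<open>V\<close> have
  left index at most \<open>r\<close>, so whatever new edge a move leaves behind is supplied by the
  Ferrers condition.\<close>

lemma conn_gather:
  assumes R: "R r j" and V: "set_mset V \<subseteq> gens" "V \<noteq> {#}"
    and max: "\<And>i s. R i s \<Longrightarrow> g i s \<in># V \<Longrightarrow> i \<le> r"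
    and "Poly_Mapping.lookup (b + \<Sum>\<^sub># V) (X r) > 0" "Poly_Mapping.lookup (b + \<Sum>\<^sub># V) (Y j) > 0"
  shows "\<exists>b' V'. conn gens (b, V) (b', V' + {#g r j#})"
proof -
  have "Poly_Mapping.lookup b (X r) > 0 \<or> (\<exists>s. R r s \<and> g r s \<in># V)"
    using lookup_sum_mset_pos[OF assms(5)] V(1) lookup_g_X R by (fastforce simp: gens_def)
  moreover have "Poly_Mapping.lookup b (Y j) > 0 \<or> (\<exists>i. R i j \<and> g i j \<in># V)"
    using lookup_sum_mset_pos[OF assms(6)] V(1) lookup_g_Y R by (fastforce simp: gens_def)
  ultimately consider
      (edge_edge) s i where "R r s" "g r s \<in># V" "R i j" "g i j \<in># V"
    | (edge_coeff) s where "R r s" "g r s \<in># V" "Poly_Mapping.lookup b (Y j) > 0"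
    | (coeff_edge) i where "Poly_Mapping.lookup b (X r) > 0" "R i j" "g i j \<in># V"
    | (coeff_coeff) "Poly_Mapping.lookup b (X r) > 0" "Poly_Mapping.lookup b (Y j) > 0"
    by metis
  then show ?thesis
  proof cases
    case edge_edge
    show ?thesis
    proof (cases "g i j = g r s")
      \<comment> \<open>If both variables come from one edge, that edge is already
        \<open>g r j\<close>.\<close>
      case True
      then have "Poly_Mapping.lookup (g i j) (X r) > 0"
        by (simp add: edge_gen_def lookup_add)
      then have "i = r" using lookup_g_X edge_edge R by blast
      moreover obtain V' where "V = V' + {#g i j#}" using edge_edge(4) by (rule mset_split_member)
      ultimately show ?thesis using conn_refl by metis
    next
      case False
      obtain V' where V': "V = V' + {#g i j#}" using edge_edge(4) by (rule mset_split_member)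
      with False edge_edge(2) have "g r s \<in># V'" by auto
      then obtain V'' where V'': "V' = V'' + {#g r s#}" by (rule mset_split_member)
      \<comment> \<open>Exchanging the right ends of edges (i,j) and (r,s) requires the edge (i,s),
        which lies below (r,s) because \<open>i \<le> r\<close>.\<close>
      have "R i s" using edge_edge(1) max[OF edge_edge(3,4)] by (rule down) simp
      have "conn gens (b, V'' + {#g i j, g r s#}) (b, V'' + {#g i s, g r j#})"
      proof (rule conn_quad)
        show "g i j + g r s = g i s + g r j" by (simp add: edge_gen_def ac_simps)
      qed (use V(1) V' V'' edge_edge R \<open>R i s\<close> in \<open>auto intro: g_in_gens\<close>)
      then have "conn gens (b, V) (b, (V'' + {#g i s#}) + {#g r j#})"
        unfolding V' V'' by (simp add: add_mset_commute)
      then show ?thesis by blast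
    qed
  next
    case edge_coeff
    obtain V' where V': "V = V' + {#g r s#}" using edge_coeff(2) by (rule mset_split_member)
    obtain b' where b': "b = b' + Poly_Mapping.single (Y j) 1"
      using edge_coeff(3) by (rule expo_split_single)
    show ?thesis
      using conn_change_Y[OF edge_coeff(1) R, of V' b'] V(1) unfolding V' b' by auto
  next
    case coeff_edge
    obtain V' where V': "V = V' + {#g i j#}" using coeff_edge(3) by (rule mset_split_member)
    obtain b' where b': "b = b' + Poly_Mapping.single (X r) 1"
      using coeff_edge(1) by (rule expo_split_single)
    show ?thesis
      using conn_change_X[OF coeff_edge(2) R, of V' b'] V(1) unfolding V' b' by auto
  next
    case coeff_coeff
    \<comment> \<open>Any edge of \<open>V\<close> can be converted by two linear moves, first its
      right end to \<open>j\<close> and then its left end to \<open>r\<close>. The intermediate edge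
      (i,j) lies below (r,j).\<close>
    obtain i s where edge: "R i s" "g i s \<in># V" using V by (rule some_edge)
    then obtain V' where V': "V = V' + {#g i s#}" by (meson mset_split_member)
    have "R i j" using R max[OF edge] by (rule down) simp
    obtain b' where b': "b = b' + Poly_Mapping.single (X r) 1"
      using coeff_coeff(1) by (rule expo_split_single)
    \<comment> \<open>Removing \<open>X r\<close> from \<open>b\<close> leaves \<open>Y j\<close>
      present, the two variables being different.\<close>
    have "Poly_Mapping.lookup b' (Y j) > 0"
      using coeff_coeff(2) X_Y[OF R R] unfolding b' by (simp add: lookup_add lookup_single when_def)
    then obtain b'' where b'': "b' = b'' + Poly_Mapping.single (Y j) 1" by (rule expo_split_single)
    have V'_gens: "set_mset V' \<subseteq> gens" using V(1) V' by simp
    have "conn gens (b, V) (b'' + Poly_Mapping.single (Y s) 1 + Poly_Mapping.single (X r) 1, V' + {#g i j#})"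
      using conn_change_Y[OF edge(1) \<open>R i j\<close> V'_gens, of "b'' + Poly_Mapping.single (X r) 1"]
      unfolding b' b'' V' by (simp only: add.assoc add.commute add.left_commute)
    moreover have "conn gens (b'' + Poly_Mapping.single (Y s) 1 + Poly_Mapping.single (X r) 1, V' + {#g i j#})
      (b'' + Poly_Mapping.single (Y s) 1 + Poly_Mapping.single (X i) 1, V' + {#g r j#})"
      using \<open>R i j\<close> R V'_gens by (rule conn_change_X)
    ultimately have "conn gens (b, V) (b'' + Poly_Mapping.single (Y s) 1 + Poly_Mapping.single (X i) 1, V' + {#g r j#})"
      by (rule conn_trans)
    then show ?thesis by blast
  qed
qed

text \<open>Induction on the number of generators; once none is left, equal sums force equal
  coefficient monomials.\<close>

lemma linked_gens: "linked gens"
  unfolding linked_def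
proof (intro allI impI)
  fix a b :: "'v expo" and U V
  assume "set_mset U \<subseteq> gens" "set_mset V \<subseteq> gens" "size U = size V" "a + \<Sum>\<^sub># U = b + \<Sum>\<^sub># V"
  then show "conn gens (a, U) (b, V)"
  proof (induction "size U" arbitrary: a b U V)
    case 0
    then show ?case by (simp add: conn_refl)
  next
    case (Suc n)
    \<comment> \<open>The argument is isolated for the case that the edge of largest left index lies
      in the first multiset, so that it can be used with the two sides interchanged.\<close>
    have step: "conn gens (a, U) (b, V)"
      if U: "set_mset U \<subseteq> gens" "size U = Suc n" and V: "set_mset V \<subseteq> gens" "size V = Suc n"
        and eq: "a + \<Sum>\<^sub># U = b + \<Sum>\<^sub># V" and r: "R r j" "g r j \<in># U"
        and max: "\<And>i s. R i s \<Longrightarrow> g i s \<in># V \<Longrightarrow> i \<le> r" for a b U V r j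
    proof -
      obtain U' where U': "U = U' + {#g r j#}" using r(2) by (rule mset_split_member)
      have pos: "Poly_Mapping.lookup (b + \<Sum>\<^sub># V) (X r) > 0" "Poly_Mapping.lookup (b + \<Sum>\<^sub># V) (Y j) > 0"
        unfolding eq[symmetric] U' by (simp_all add: lookup_add edge_gen_def)
      have "V \<noteq> {#}" using V(2) by auto
      have "\<exists>b' V'. conn gens (b, V) (b', V' + {#g r j#})"
        by (rule conn_gather[OF r(1) V(1) \<open>V \<noteq> {#}\<close> _ pos]) (rule max)
      then obtain b' V' where conn: "conn gens (b, V) (b', V' + {#g r j#})" by blast
      note inv = conn_invariant[OF conn, simplified]
      have "conn gens (a, U') (b', V')"
      proof (rule Suc.hyps(1))
        show "n = size U'" using U(2) by (simp add: U')
        show "size U' = size V'" using inv(2) U(2) V(2) by (simp add: U')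
        show "set_mset U' \<subseteq> gens" using U(1) by (simp add: U')
        show "set_mset V' \<subseteq> gens" using inv(3) V(1) by simp
        have "g r j + (a + \<Sum>\<^sub># U') = g r j + (b' + \<Sum>\<^sub># V')"
          using eq inv(1) by (simp add: U' add.left_commute)
        then show "a + \<Sum>\<^sub># U' = b' + \<Sum>\<^sub># V'" by (rule add_left_imp_eq)
      qed
      from conn_context[OF this, of "{#g r j#}" 0] have "conn gens (a, U) (b', V' + {#g r j#})"
        using g_in_gens[OF r(1)] by (simp add: U')
      with conn show ?thesis by (meson conn_sym conn_trans)
    qed
    let ?N = "{i. \<exists>j. R i j \<and> g i j \<in># U + V}"
    \<comment> \<open>By \<open>inj_g\<close> the finitely many members of \<open>U + V\<close> come
      from finitely many index pairs, so a largest left index exists.\<close>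
    have "finite ((\<lambda>(i, j). g i j) -` set_mset (U + V) \<inter> {(i, j). R i j})"
      using inj_g by (rule finite_vimage_IntI[rotated]) simp
    moreover have "?N = fst ` ((\<lambda>(i, j). g i j) -` set_mset (U + V) \<inter> {(i, j). R i j})" by force
    ultimately have fin: "finite ?N" by simp
    have "U \<noteq> {#}" using Suc.hyps(2) by auto
    then obtain i s where "R i s" "g i s \<in># U" using Suc.prems(1) some_edge by blast
    then have ne: "?N \<noteq> {}" by auto
    define r where "r = Max ?N"
    have "r \<in> ?N" unfolding r_def using fin ne by (rule Max_in)
    then obtain j where j: "R r j" "g r j \<in># U + V" by blast
    have max: "i \<le> r" if "R i s" "g i s \<in># U + V" for i s
      unfolding r_def using fin by (rule Max_ge) (use that in blast)
    have sizes: "size U = Suc n" "size V = Suc n" using Suc.hyps(2) Suc.prems(3) by simp_all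
    show ?case
    proof (cases "g r j \<in># U")
      case True
      show ?thesis
        by (rule step[OF Suc.prems(1) sizes(1) Suc.prems(2) sizes(2) Suc.prems(4) j(1) True])
          (erule max, simp)
    next
      case False
      with j(2) have inV: "g r j \<in># V" by simp
      have "conn gens (b, V) (a, U)"
        by (rule step[OF Suc.prems(2) sizes(2) Suc.prems(1) sizes(1) Suc.prems(4)[symmetric] j(1) inV])
          (erule max, simp)
      then show ?thesis by (rule conn_sym)
    qed
  qed
qed

end

lemma linked_ferrers_graph:
  assumes "ferrers_graph V E"
  shows "linked {edge_gen u v |u v. {u, v} \<in> E}"
proof -
  from assms obtain xs ys where d: "distinct (xs @ ys)"
    and E: "E \<subseteq> {{xs ! i, ys ! j} |i j. i < length xs \<and> j < length ys}"
    and down: "\<forall>i<length xs. \<forall>j<length ys. {xs ! i, ys ! j} \<in> E \<longrightarrow>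
      (\<forall>r\<le>i. \<forall>s\<le>j. {xs ! r, ys ! s} \<in> E)"
    unfolding ferrers_graph_def by (elim exE conjE)
  define R where "R i j \<longleftrightarrow> i < length xs \<and> j < length ys \<and> {xs ! i, ys ! j} \<in> E" for i j
  interpret ferrers_pattern "\<lambda>i. xs ! i" "\<lambda>j. ys ! j" R
  proof
    show "R r s" if "R i j" "r \<le> i" "s \<le> j" for i j r s
      using that down by (auto simp: R_def)
    show "i = i'" if "R i j" "R i' j'" "xs ! i = xs ! i'" for i j i' j'
      using that d by (auto simp: R_def nth_eq_iff_index_eq)
    show "j = j'" if "R i j" "R i' j'" "ys ! j = ys ! j'" for i j i' j'
      using that d by (auto simp: R_def nth_eq_iff_index_eq)
    show "xs ! i \<noteq> ys ! j'" if "R i j" "R i' j'" for i j i' j'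
    proof -
      have "xs ! i \<in> set xs" "ys ! j' \<in> set ys" using that by (simp_all add: R_def)
      with d show ?thesis by auto
    qed
  qed
  have "{edge_gen u v |u v. {u, v} \<in> E} = gens"
  proof (intro equalityI subsetI)
    fix f assume "f \<in> {edge_gen u v |u v. {u, v} \<in> E}"
    then obtain u v where uv: "f = edge_gen u v" "{u, v} \<in> E" by blast
    with E obtain i j where ij: "{u, v} = {xs ! i, ys ! j}" "i < length xs" "j < length ys" by blast
    then have "R i j" using uv(2) by (simp add: R_def)
    moreover have "f = edge_gen (xs ! i) (ys ! j)"
      \<comment> \<open>An unordered edge may list its left vertex second; \<open>edge_gen\<close>
        is symmetric.\<close>
      using ij(1) uv(1) by (auto simp: doubleton_eq_iff edge_gen_def add.commute)
    ultimately show "f \<in> gens" by (auto simp: gens_def)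
  qed (auto simp: gens_def R_def)
  with linked_gens show ?thesis by simp
qed

section \<open>Minimal generators\<close>

lemma min_gens_equal_degree:
  fixes P :: "'x expo set"
  assumes "\<And>a. a \<in> P \<Longrightarrow> mdeg a = d"
  shows "min_gens (ideal.span (monomial ` P) :: ('x, 'k::field) mpoly set) = P"
proof -
  let ?I = "ideal.span (monomial ` P) :: ('x, 'k) mpoly set"
  have I: "monomial_ideal ?I" by (auto simp: monomial_ideal_def)
  have "ideal.span (monomial ` M') \<noteq> ?I" if M': "M' \<subset> P" for M'
  proof
    assume eq: "ideal.span (monomial ` M') = ?I"
    from M' obtain a where a: "a \<in> P" "a \<notin> M'" by blast
    then have "(monomial a :: ('x, 'k) mpoly) \<in> ?I" by (auto intro: ideal.span_base)
    then obtain m c where m: "m \<in> M'" "a = c + m"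
      unfolding eq[symmetric] monomial_in_span_iff by blast
    then have "mdeg c = 0" using assms[of a] assms[of m] a M' by (auto simp: mdeg_plus)
    with m a show False by (simp add: mdeg_eq_0)
  qed
  then have "is_min_gens ?I P" by (simp add: is_min_gens_def)
  then show ?thesis
    using is_min_gens_min_gens[OF I] unfolding is_min_gens_iff[OF I] by simp
qed

lemma edge_ideal_eq:
  "(edge_ideal E :: ('x, 'k::field) mpoly set) = ideal.span (monomial ` {edge_gen u v |u v. {u, v} \<in> E})"
  unfolding edge_ideal_def
  by (rule arg_cong[of _ _ ideal.span]) (auto simp: var_def monomial_def mult_single edge_gen_def)

lemma mdeg_edge_gen: "mdeg (edge_gen u v) = 2"
  unfolding edge_gen_def mdeg_plus mdeg_single by simp

lemma ideal_mult_span: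
  fixes A B :: "'a::comm_ring_1 set"
  shows "ideal_mult (ideal.span A) (ideal.span B) = ideal.span {a * b |a b. a \<in> A \<and> b \<in> B}"
    (is "_ = ideal.span ?C")
proof -
  have step: "a * y \<in> ideal.span ?C" if a: "a \<in> A" and y: "y \<in> ideal.span B" for a y
    using y
  proof (induction rule: ideal.span_induct_alt)
    case (step c b y)
    have "a * b \<in> ?C" using a step.hyps by blast
    then have ab: "a * b \<in> ideal.span ?C" by (rule ideal.span_base)
    have "a * (c * b + y) = c * (a * b) + a * y" by (simp only: distrib_left mult.left_commute)
    then show ?case
      using ideal.span_add[OF ideal.span_scale[OF ab, of c] step.IH] by (rule ssubst)
  qed (simp add: ideal.span_zero)
  have prod: "x * y \<in> ideal.span ?C" if x: "x \<in> ideal.span A" and y: "y \<in> ideal.span B" for x y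
    using x
  proof (induction rule: ideal.span_induct_alt)
    case step': (step c a x)
    have "(c * a + x) * y = c * (a * y) + x * y" by (simp only: distrib_right mult.assoc)
    then show ?case
      using ideal.span_add[OF ideal.span_scale[OF step[OF step'.hyps(1) y], of c] step'.IH]
      by (rule ssubst)
  qed (simp add: ideal.span_zero)
  show ?thesis
    unfolding ideal_mult_def
  proof (rule antisym)
    show "ideal.span {a * b |a b. a \<in> ideal.span A \<and> b \<in> ideal.span B} \<subseteq> ideal.span ?C"
      using prod by (intro ideal.span_minimal ideal.subspace_span) auto
    show "ideal.span ?C \<subseteq> ideal.span {a * b |a b. a \<in> ideal.span A \<and> b \<in> ideal.span B}"
      by (intro ideal.span_mono) (auto intro: ideal.span_base)
  qed
qed

text \<open>Each further factor contributes one chosen variable; the empty product is the unit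
  ideal, generated by the monomial with exponent 0.\<close>

lemma ideal_product_variables:
  "(foldr (\<lambda>V. ideal_mult (ideal.span (var ` V))) Vs UNIV :: ('x, 'k::field) mpoly set)
    = ideal.span (monomial ` choice_sums Vs)"
proof (induction Vs)
  case Nil
  have "(1 :: ('x, 'k) mpoly) \<in> ideal.span (monomial ` {0})"
    by (rule ideal.span_base) (simp add: monomial_def)
  then have "x \<in> ideal.span (monomial ` {0})" for x :: "('x, 'k) mpoly"
    using ideal.span_scale[of 1 _ x] by simp
  then show ?case by (auto simp: choice_sums_Nil)
next
  case (Cons V Vs)
  have "{a * b |a b. a \<in> var ` V \<and> b \<in> monomial ` choice_sums Vs} =
      (monomial ` choice_sums (V # Vs) :: ('x, 'k) mpoly set)"
  proof -
    have eq: "var v * monomial b = (monomial (Poly_Mapping.single v 1 + b) :: ('x, 'k) mpoly)" for v b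
      by (simp add: var_def monomial_def mult_single)
    have "{a * b |a b. a \<in> var ` V \<and> b \<in> monomial ` choice_sums Vs} =
        {var v * monomial b :: ('x, 'k) mpoly |v b. v \<in> V \<and> b \<in> choice_sums Vs}" by blast
    then show ?thesis unfolding eq choice_sums_Cons by blast
  qed
  then show ?case by (simp add: Cons ideal_mult_span)
qed

section \<open>The Rees ideal\<close>

lemma poly_mapping_sum_singles:
  "p = (\<Sum>u\<in>Poly_Mapping.keys p. Poly_Mapping.single u (Poly_Mapping.lookup p u))"
proof (rule poly_mapping_eqI)
  fix k
  show "Poly_Mapping.lookup p k = Poly_Mapping.lookup
      (\<Sum>u\<in>Poly_Mapping.keys p. Poly_Mapping.single u (Poly_Mapping.lookup p u)) k"
    by (cases "k \<in> Poly_Mapping.keys p") (simp_all add: lookup_sum lookup_single when_def in_keys_iff)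
qed

text \<open>The image under the Rees map of the monomial with exponent \<open>u\<close> in the
  adjoined variables.\<close>

definition gens_prod :: "('x expo \<Rightarrow>\<^sub>0 nat) \<Rightarrow> ('x, 'k::field) mpoly poly" where
  "gens_prod u = (\<Prod>f\<in>Poly_Mapping.keys u. monom (monomial f) 1 ^ Poly_Mapping.lookup u f)"

lemma gens_prod_superset:
  assumes "finite A" "Poly_Mapping.keys u \<subseteq> A"
  shows "gens_prod u = (\<Prod>f\<in>A. monom (monomial f) 1 ^ Poly_Mapping.lookup u f)"
  unfolding gens_prod_def using assms by (intro prod.mono_neutral_left) (auto simp: in_keys_iff)

lemma gens_prod_add: "gens_prod (u + v) = gens_prod u * gens_prod v"
proof -
  let ?A = "Poly_Mapping.keys u \<union> Poly_Mapping.keys v"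
  have "gens_prod (u + v) = (\<Prod>f\<in>?A. monom (monomial f) 1 ^ Poly_Mapping.lookup (u + v) f)"
    by (rule gens_prod_superset) (simp_all add: keys_add)
  then show ?thesis
    by (simp add: lookup_add power_add prod.distrib gens_prod_superset[of ?A])
qed

text \<open>Zero coefficients contribute nothing, so polynomials with different supports can be
  expanded over a common one and added termwise.\<close>

lemma rees_map_superset:
  assumes "finite A" "Poly_Mapping.keys p \<subseteq> A"
  shows "rees_map p = (\<Sum>u\<in>A. [:Poly_Mapping.lookup p u:] * gens_prod u)"
  unfolding rees_map_def gens_prod_def[symmetric]
  using assms by (intro sum.mono_neutral_left) (auto simp: in_keys_iff)

lemma rees_map_add: "rees_map (p + q) = rees_map p + rees_map q"
proof -
  let ?A = "Poly_Mapping.keys p \<union> Poly_Mapping.keys q"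
  have "rees_map (p + q) = (\<Sum>u\<in>?A. [:Poly_Mapping.lookup (p + q) u:] * gens_prod u)"
    by (rule rees_map_superset) (simp_all add: keys_add)
  also have "\<dots> = (\<Sum>u\<in>?A. [:Poly_Mapping.lookup p u:] * gens_prod u + [:Poly_Mapping.lookup q u:] * gens_prod u)"
    by (simp add: lookup_add smult_add_left)
  also have "\<dots> = rees_map p + rees_map q"
    by (simp add: sum.distrib rees_map_superset[of ?A])
  finally show ?thesis .
qed

lemma rees_map_zero: "rees_map 0 = 0"
  by (simp add: rees_map_def)

lemma rees_map_sum: "rees_map (\<Sum>x\<in>A. f x) = (\<Sum>x\<in>A. rees_map (f x))"
  by (induction A rule: infinite_finite_induct) (simp_all add: rees_map_zero rees_map_add)

lemma rees_map_single: "rees_map (Poly_Mapping.single u c) = smult c (gens_prod u)"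
  using rees_map_superset[of "{u}" "Poly_Mapping.single u c"] by simp

lemma rees_map_mult: "rees_map (p * q) = rees_map p * rees_map q"
proof -
  have single: "rees_map (Poly_Mapping.single u c * Poly_Mapping.single v d) =
      rees_map (Poly_Mapping.single u c) * rees_map (Poly_Mapping.single v d)"
    for u v :: "'a expo \<Rightarrow>\<^sub>0 nat" and c d :: "('a, 'b) mpoly"
    by (simp add: mult_single rees_map_single gens_prod_add mult.commute)
  have "rees_map (p * q) = rees_map ((\<Sum>u\<in>Poly_Mapping.keys p. Poly_Mapping.single u (Poly_Mapping.lookup p u))
      * (\<Sum>v\<in>Poly_Mapping.keys q. Poly_Mapping.single v (Poly_Mapping.lookup q v)))"
    by (simp flip: poly_mapping_sum_singles)
  also have "\<dots> = rees_map (\<Sum>u\<in>Poly_Mapping.keys p. Poly_Mapping.single u (Poly_Mapping.lookup p u))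
      * rees_map (\<Sum>v\<in>Poly_Mapping.keys q. Poly_Mapping.single v (Poly_Mapping.lookup q v))"
    by (simp add: rees_map_sum sum_product single)
  finally show ?thesis by (simp flip: poly_mapping_sum_singles)
qed

lemma rees_map_diff: "rees_map (p - q) = rees_map p - rees_map q"
  using rees_map_add[of "p - q" q] by simp

section \<open>The Rees ring as a subring, and ideals generated in it\<close>

lemma rees_ring_zero: "0 \<in> rees_ring I"
  by (simp add: rees_ring_def)

lemma rees_ring_add: "p \<in> rees_ring I \<Longrightarrow> q \<in> rees_ring I \<Longrightarrow> p + q \<in> rees_ring I"
  unfolding rees_ring_def using keys_add[of p q] by blast

lemma rees_ring_diff: "p \<in> rees_ring I \<Longrightarrow> q \<in> rees_ring I \<Longrightarrow> p - q \<in> rees_ring I"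
  unfolding rees_ring_def using keys_diff[of p q] by blast

lemma rees_ring_mult:
  assumes "p \<in> rees_ring I" "q \<in> rees_ring I"
  shows "p * q \<in> rees_ring I"
  unfolding rees_ring_def
proof (intro CollectI ballI)
  fix w assume "w \<in> Poly_Mapping.keys (p * q)"
  then obtain u v where "w = u + v" "u \<in> Poly_Mapping.keys p" "v \<in> Poly_Mapping.keys q"
    using keys_mult[of p q] by blast
  with assms show "Poly_Mapping.keys w \<subseteq> min_gens I"
    using keys_add[of u v] unfolding rees_ring_def by blast
qed

lemma single_in_rees_ring: "Poly_Mapping.keys u \<subseteq> min_gens I \<Longrightarrow> Poly_Mapping.single u c \<in> rees_ring I"
  by (auto simp: rees_ring_def)

lemma rees_ring_one: "1 \<in> rees_ring I"
  using single_in_rees_ring[of 0 I 1] by simp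

definition subring_closed :: "'a::comm_ring_1 set \<Rightarrow> bool" where
  "subring_closed T \<longleftrightarrow> 0 \<in> T \<and> 1 \<in> T \<and> (\<forall>x\<in>T. \<forall>y\<in>T. x + y \<in> T \<and> x - y \<in> T \<and> x * y \<in> T)"

lemma subring_closed_rees_ring: "subring_closed (rees_ring I)"
  by (simp add: subring_closed_def rees_ring_zero rees_ring_one rees_ring_add rees_ring_diff rees_ring_mult)

lemma ideal_generated_in_base:
  assumes "subring_closed T" "b \<in> B"
  shows "b \<in> ideal_generated_in T B"
  unfolding ideal_generated_in_def using assms
  by (intro CollectI exI[of _ "{b}"] exI[of _ "\<lambda>_. 1"]) (simp add: subring_closed_def)

lemma ideal_generated_in_zero: "0 \<in> ideal_generated_in T B"
  unfolding ideal_generated_in_def by (intro CollectI exI[of _ "{}"]) simp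

lemma ideal_generated_in_scale:
  assumes "subring_closed T" "t \<in> T" "x \<in> ideal_generated_in T B"
  shows "t * x \<in> ideal_generated_in T B"
proof -
  from assms(3) obtain F r where F: "x = (\<Sum>b\<in>F. r b * b)" "finite F" "F \<subseteq> B" "\<forall>b\<in>F. r b \<in> T"
    unfolding ideal_generated_in_def by blast
  have "t * x = (\<Sum>b\<in>F. (t * r b) * b)"
    unfolding F(1) sum_distrib_left by (simp only: mult.assoc)
  moreover have "\<forall>b\<in>F. t * r b \<in> T" using F assms(1,2) by (simp add: subring_closed_def)
  ultimately show ?thesis
    unfolding ideal_generated_in_def using F by (intro CollectI exI[of _ F] exI[of _ "\<lambda>b. t * r b"]) simp
qed

lemma ideal_generated_in_add:
  assumes T: "subring_closed T" and "x \<in> ideal_generated_in T B" "y \<in> ideal_generated_in T B"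
  shows "x + y \<in> ideal_generated_in T B"
proof -
  from assms(2) obtain F r where F: "x = (\<Sum>b\<in>F. r b * b)" "finite F" "F \<subseteq> B" "\<forall>b\<in>F. r b \<in> T"
    unfolding ideal_generated_in_def by blast
  from assms(3) obtain G s where G: "y = (\<Sum>b\<in>G. s b * b)" "finite G" "G \<subseteq> B" "\<forall>b\<in>G. s b \<in> T"
    unfolding ideal_generated_in_def by blast
  \<comment> \<open>Both coefficient families are extended by 0 to the union of the two index
    sets.\<close>
  let ?r = "\<lambda>b. if b \<in> F then r b else 0" and ?s = "\<lambda>b. if b \<in> G then s b else 0"
  have x: "x = (\<Sum>b\<in>F \<union> G. ?r b * b)"
    unfolding F(1) using F(2) G(2) by (intro sum.mono_neutral_cong_left) auto
  have y: "y = (\<Sum>b\<in>F \<union> G. ?s b * b)"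
    unfolding G(1) using F(2) G(2) by (intro sum.mono_neutral_cong_left) auto
  have "x + y = (\<Sum>b\<in>F \<union> G. (?r b + ?s b) * b)"
    unfolding x y sum.distrib[symmetric] by (simp only: distrib_right)
  moreover have "\<forall>b\<in>F \<union> G. ?r b + ?s b \<in> T" using F(4) G(4) T by (simp add: subring_closed_def)
  ultimately show ?thesis
    unfolding ideal_generated_in_def using F(2,3) G(2,3)
    by (intro CollectI exI[of _ "F \<union> G"] exI[of _ "\<lambda>b. ?r b + ?s b"]) simp
qed

lemma ideal_generated_in_sum:
  assumes "subring_closed T" "\<And>x. x \<in> A \<Longrightarrow> f x \<in> ideal_generated_in T B"
  shows "(\<Sum>x\<in>A. f x) \<in> ideal_generated_in T B"
  using assms(2)
  by (induction A rule: infinite_finite_induct)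
    (simp_all add: ideal_generated_in_zero ideal_generated_in_add[OF assms(1)])

lemma ideal_generated_in_uminus:
  assumes T: "subring_closed T" and "x \<in> ideal_generated_in T B"
  shows "- x \<in> ideal_generated_in T B"
proof -
  have "0 - 1 \<in> T" using T unfolding subring_closed_def by blast
  from ideal_generated_in_scale[OF T this assms(2)] show ?thesis by simp
qed

section \<open>Monomials and binomials of the Rees ring given by multisets of generators\<close>

definition yexp :: "'a multiset \<Rightarrow> 'a \<Rightarrow>\<^sub>0 nat" where
  "yexp U = (\<Sum>f\<in>#U. Poly_Mapping.single f 1)"

lemma yexp_union: "yexp (U + V) = yexp U + yexp V"
  by (simp add: yexp_def)

lemma keys_yexp: "Poly_Mapping.keys (yexp U) = set_mset U"
proof -
  have "Poly_Mapping.lookup (yexp U) = count U"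
    by (induction U) (auto simp: yexp_def lookup_add lookup_single when_def)
  then show ?thesis by (auto simp: in_keys_iff)
qed

lemma mdeg_yexp: "mdeg (yexp U) = size U"
proof (induction U)
  case (add x U)
  then show ?case using mdeg_single[of x] by (simp add: yexp_def mdeg_plus)
qed (simp add: yexp_def mdeg_def)

lemma gens_prod_yexp: "(gens_prod (yexp U) :: ('x, 'k::field) mpoly poly) = monom (monomial (\<Sum>\<^sub># U)) (size U)"
proof (induction U)
  case empty
  then show ?case by (simp add: yexp_def gens_prod_def monomial_def monom_0)
next
  case (add f U)
  have "yexp (add_mset f U) = Poly_Mapping.single f 1 + yexp U" by (simp add: yexp_def)
  moreover have "gens_prod (Poly_Mapping.single f 1) = (monom (monomial f) 1 :: ('x, 'k) mpoly poly)"
    by (simp add: gens_prod_def)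
  ultimately show ?case
    by (simp add: gens_prod_add add mult_monom monomial_def mult_single)
qed

definition rees_monomial :: "'x expo \<times> 'x expo multiset \<Rightarrow> ('x, 'k::field) rees_poly" where
  "rees_monomial z = Poly_Mapping.single (yexp (snd z)) (monomial (fst z))"

lemma rees_map_term:
  "rees_map (Poly_Mapping.single (yexp U) (Poly_Mapping.single a c) :: ('x, 'k::field) rees_poly)
    = monom (Poly_Mapping.single (a + \<Sum>\<^sub># U) c) (size U)"
  by (simp add: rees_map_single gens_prod_yexp smult_monom monomial_def mult_single)

lemma rees_monomial_mult:
  "rees_monomial (a + b, U + V) = rees_monomial (a, U) * rees_monomial (b, V)"
  by (simp add: rees_monomial_def yexp_union mult_single monomial_def)

lemma rees_monomial_in_ring: "set_mset (snd z) \<subseteq> min_gens I \<Longrightarrow> rees_monomial z \<in> rees_ring I"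
  unfolding rees_monomial_def by (intro single_in_rees_ring) (simp add: keys_yexp)

lemma bihomogeneous_rees_monomial: "bihomogeneous (mdeg (fst z)) (size (snd z)) (rees_monomial z)"
  by (auto simp: bihomogeneous_def rees_monomial_def monomial_def mdeg_yexp split: if_splits)

lemma bihomogeneous_diff:
  assumes "bihomogeneous d e p" "bihomogeneous d e q"
  shows "bihomogeneous d e (p - q)"
  unfolding bihomogeneous_def
proof (intro ballI conjI)
  have keys: "a \<in> Poly_Mapping.keys (Poly_Mapping.lookup p u) \<or> a \<in> Poly_Mapping.keys (Poly_Mapping.lookup q u)"
    if "a \<in> Poly_Mapping.keys (Poly_Mapping.lookup (p - q) u)" for a u
    using that keys_diff[of "Poly_Mapping.lookup p u" "Poly_Mapping.lookup q u"]
    by (auto simp: lookup_minus)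
  fix u assume "u \<in> Poly_Mapping.keys (p - q)"
  then have "u \<in> Poly_Mapping.keys p \<or> u \<in> Poly_Mapping.keys q" using keys_diff[of p q] by blast
  then show "mdeg u = e" using assms by (auto simp: bihomogeneous_def)
  fix a assume "a \<in> Poly_Mapping.keys (Poly_Mapping.lookup (p - q) u)"
  from keys[OF this] show "mdeg a = d"
    using assms unfolding bihomogeneous_def by (metis empty_iff in_keys_iff keys_zero)
qed

definition rees_quadrics :: "('x, 'k::field) mpoly set \<Rightarrow> ('x, 'k) rees_poly set" where
  "rees_quadrics I = {p \<in> rees_ideal I. bihomogeneous 0 2 p \<or> bihomogeneous 1 1 p}"

text \<open>Both monomials have the same image, with exponent \<open>a\<close> plus the sum of
  \<open>U\<close> in the variables of \<open>S\<close> and with \<open>size U\<close> as power of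
  \<open>t\<close>.\<close>

lemma binomial_in_rees_ideal:
  assumes "set_mset U \<subseteq> min_gens I" "set_mset V \<subseteq> min_gens I" "size U = size V" "a + \<Sum>\<^sub># U = b + \<Sum>\<^sub># V"
  shows "rees_monomial (a, U) - rees_monomial (b, V) \<in> rees_ideal I"
proof -
  have "rees_map (rees_monomial (a, U) - rees_monomial (b, V) :: ('a, 'b) rees_poly) = 0"
    unfolding rees_map_diff using assms(3,4) by (simp add: rees_monomial_def monomial_def rees_map_term)
  moreover have "rees_monomial (a, U) - rees_monomial (b, V) \<in> rees_ring I"
    using assms(1,2) by (intro rees_ring_diff rees_monomial_in_ring) simp_all
  ultimately show ?thesis by (simp add: rees_ideal_def)
qed

text \<open>Along a chain of moves the binomial telescopes into the differences of single moves, and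
  each of these is a monomial times a binomial of bidegree (0,2) or (1,1).\<close>

lemma binomial_generated:
  fixes I :: "('a, 'b::field) mpoly set"
  assumes "conn (min_gens I) z z'" "set_mset (snd z) \<subseteq> min_gens I"
  shows "rees_monomial z - rees_monomial z' \<in> ideal_generated_in (rees_ring I) (rees_quadrics I)"
  using assms
proof induction
  case (conn_refl z)
  then show ?case by (simp add: ideal_generated_in_zero)
next
  case (conn_sym z z')
  then have "rees_monomial z - rees_monomial z' \<in> ideal_generated_in (rees_ring I) (rees_quadrics I)"
    using conn_invariant(3) by blast
  from ideal_generated_in_uminus[OF subring_closed_rees_ring this] show ?case by simp
next
  case (conn_trans z z' z'')
  then have "rees_monomial z - rees_monomial z' \<in> ideal_generated_in (rees_ring I) (rees_quadrics I)"
      "rees_monomial z' - rees_monomial z'' \<in> ideal_generated_in (rees_ring I) (rees_quadrics I)"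
    using conn_invariant(3) by blast+
  from ideal_generated_in_add[OF subring_closed_rees_ring this] show ?case by simp
next
  case (conn_quad U f g f' g' a)
  \<comment> \<open>The binomial of the move with its cofactor \<open>rees_monomial (a, U)\<close>
    stripped off.\<close>
  let ?q = "rees_monomial (0, {#f, g#}) - rees_monomial (0, {#f', g'#}) :: ('a, 'b) rees_poly"
  have "?q \<in> rees_ideal I" using conn_quad by (intro binomial_in_rees_ideal) simp_all
  moreover have "bihomogeneous 0 2 ?q"
    using bihomogeneous_rees_monomial[of "(0, {#f, g#})"] bihomogeneous_rees_monomial[of "(0, {#f', g'#})"]
    by (intro bihomogeneous_diff) (simp_all add: mdeg_def numeral_2_eq_2)
  ultimately have "?q \<in> ideal_generated_in (rees_ring I) (rees_quadrics I)"
    by (intro ideal_generated_in_base[OF subring_closed_rees_ring]) (simp add: rees_quadrics_def)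
  moreover have "rees_monomial (a, U) \<in> rees_ring I"
    using conn_quad.hyps(1) by (intro rees_monomial_in_ring) simp
  ultimately have "rees_monomial (a, U) * ?q \<in> ideal_generated_in (rees_ring I) (rees_quadrics I)"
    by (intro ideal_generated_in_scale[OF subring_closed_rees_ring])
  then show ?case
    unfolding right_diff_distrib rees_monomial_mult[symmetric] by simp
next
  case (conn_lin U f f' i j a)
  let ?q = "rees_monomial (Poly_Mapping.single i 1, {#f#}) - rees_monomial (Poly_Mapping.single j 1, {#f'#})
    :: ('a, 'b) rees_poly"
  have "?q \<in> rees_ideal I" using conn_lin by (intro binomial_in_rees_ideal) simp_all
  moreover have "bihomogeneous 1 1 ?q"
    using bihomogeneous_rees_monomial[of "(Poly_Mapping.single i 1, {#f#})"]
      bihomogeneous_rees_monomial[of "(Poly_Mapping.single j 1, {#f'#})"]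
    by (intro bihomogeneous_diff) (simp_all add: mdeg_def)
  ultimately have "?q \<in> ideal_generated_in (rees_ring I) (rees_quadrics I)"
    by (intro ideal_generated_in_base[OF subring_closed_rees_ring]) (simp add: rees_quadrics_def)
  moreover have "rees_monomial (a, U) \<in> rees_ring I"
    using conn_lin.hyps(1) by (intro rees_monomial_in_ring) simp
  ultimately have "rees_monomial (a, U) * ?q \<in> ideal_generated_in (rees_ring I) (rees_quadrics I)"
    by (intro ideal_generated_in_scale[OF subring_closed_rees_ring])
  then show ?case
    unfolding right_diff_distrib rees_monomial_mult[symmetric] by simp
qed

text \<open>Modulo the ideal, \<open>F x\<close> depends only on the class \<open>G x\<close>, so it
  may be replaced by its value at a representative \<open>r (G x)\<close>. After that replacement
  the coefficients of each class add up to zero.\<close>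

lemma graded_kernel_sum:
  fixes F :: "'i \<Rightarrow> 'r::comm_ring_1" and C :: "'i \<Rightarrow> 'r"
  assumes T: "subring_closed T" and K: "finite K"
    and C: "\<And>x. x \<in> K \<Longrightarrow> C x \<in> T"
    and F: "\<And>x y. x \<in> K \<Longrightarrow> y \<in> K \<Longrightarrow> G x = G y \<Longrightarrow> F x - F y \<in> ideal_generated_in T B"
    and zero: "\<And>c. (\<Sum>x | x \<in> K \<and> G x = c. C x) = 0"
  shows "(\<Sum>x\<in>K. C x * F x) \<in> ideal_generated_in T B"
proof -
  define r where "r = inv_into K G"
  have r: "r (G x) \<in> K" "G (r (G x)) = G x" if "x \<in> K" for x
    using that by (auto simp: r_def inv_into_into f_inv_into_f)
  have "(\<Sum>x\<in>K. C x * F (r (G x))) = (\<Sum>c\<in>G ` K. \<Sum>x | x \<in> K \<and> G x = c. C x * F (r (G x)))"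
    using K by (rule sum.image_gen)
  also have "\<dots> = (\<Sum>c\<in>G ` K. (\<Sum>x | x \<in> K \<and> G x = c. C x) * F (r c))"
    by (simp add: sum_distrib_right)
  also have "\<dots> = 0" by (simp add: zero)
  finally have "(\<Sum>x\<in>K. C x * F x) = (\<Sum>x\<in>K. C x * (F x - F (r (G x))))"
    by (simp add: right_diff_distrib sum_subtractf)
  moreover have "(\<Sum>x\<in>K. C x * (F x - F (r (G x)))) \<in> ideal_generated_in T B"
    using r by (intro ideal_generated_in_sum[OF T] ideal_generated_in_scale[OF T] C F) auto
  ultimately show ?thesis by simp
qed

text \<open>The terms of a kernel element are grouped by their image monomials. Within a group the
  coefficients cancel because the images do, and linkedness makes the monomials congruent modulo the
  generated ideal.\<close>

lemma rees_ideal_subset_generated: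
  fixes I :: "('a, 'b::field) mpoly set"
  assumes "linked (min_gens I)"
  shows "rees_ideal I \<subseteq> ideal_generated_in (rees_ring I) (rees_quadrics I)"
proof
  fix p :: "('a, 'b) rees_poly" assume "p \<in> rees_ideal I"
  then have ring: "p \<in> rees_ring I" and zero: "rees_map p = 0" by (auto simp: rees_ideal_def)
  have "\<exists>U. u = yexp U" for u :: "'a expo \<Rightarrow>\<^sub>0 nat"
    unfolding yexp_def by (rule expo_as_sum_mset[of u]) blast
  then obtain m where m: "\<And>u :: 'a expo \<Rightarrow>\<^sub>0 nat. u = yexp (m u)" by metis
  \<comment> \<open>\<open>K\<close> indexes the terms of \<open>p\<close> over the field by both
    exponents, \<open>C x\<close> is the scalar coefficient embedded in the Rees ring,
    \<open>F x\<close> the monomial, and \<open>G x\<close> the exponent of its image together with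
    the power of \<open>t\<close>.\<close>
  define K where "K = Sigma (Poly_Mapping.keys p) (\<lambda>u. Poly_Mapping.keys (Poly_Mapping.lookup p u))"
  define c where "c x = Poly_Mapping.lookup (Poly_Mapping.lookup p (fst x)) (snd x)" for x
  define C where "C x = Poly_Mapping.single (0 :: 'a expo \<Rightarrow>\<^sub>0 nat) (Poly_Mapping.single (0 :: 'a expo) (c x))" for x
  define F where "F x = (rees_monomial (snd x, m (fst x)) :: ('a, 'b) rees_poly)" for x
  define G where "G x = (snd x + \<Sum>\<^sub># (m (fst x)), size (m (fst x)))" for x
  have K: "finite K" by (simp add: K_def)
  have CF: "C x * F x = Poly_Mapping.single (fst x) (Poly_Mapping.single (snd x) (c x))" for x
    unfolding C_def F_def rees_monomial_def by (simp add: mult_single monomial_def m[symmetric])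
  have "p = (\<Sum>u\<in>Poly_Mapping.keys p. Poly_Mapping.single u (Poly_Mapping.lookup p u))"
    by (rule poly_mapping_sum_singles)
  also have "\<dots> = (\<Sum>u\<in>Poly_Mapping.keys p. \<Sum>a\<in>Poly_Mapping.keys (Poly_Mapping.lookup p u). C (u, a) * F (u, a))"
  proof (rule sum.cong[OF refl])
    fix u :: "'a expo \<Rightarrow>\<^sub>0 nat"
    have "Poly_Mapping.single u (\<Sum>a\<in>A. f a) = (\<Sum>a\<in>A. Poly_Mapping.single u (f a))"
      for A :: "'a expo set" and f :: "'a expo \<Rightarrow> ('a, 'b) mpoly"
      by (induction A rule: infinite_finite_induct) (simp_all add: single_add)
    then show "Poly_Mapping.single u (Poly_Mapping.lookup p u) =
        (\<Sum>a\<in>Poly_Mapping.keys (Poly_Mapping.lookup p u). C (u, a) * F (u, a))"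
      unfolding CF by (subst poly_mapping_sum_singles) (simp add: c_def)
  qed
  also have "\<dots> = (\<Sum>x\<in>K. C x * F x)" unfolding K_def by (simp add: sum.Sigma)
  finally have p: "p = (\<Sum>x\<in>K. C x * F x)" .
  have image: "rees_map (C x * F x) = monom (Poly_Mapping.single (fst (G x)) (c x)) (snd (G x))" for x
    unfolding CF by (subst m) (simp add: rees_map_term G_def)
  show "p \<in> ideal_generated_in (rees_ring I) (rees_quadrics I)"
    unfolding p
  proof (rule graded_kernel_sum[OF subring_closed_rees_ring K])
    show "C x \<in> rees_ring I" for x unfolding C_def by (rule single_in_rees_ring) simp
    fix w
    \<comment> \<open>The coefficient of the vanishing image at the monomial encoded by
      \<open>w\<close> is the sum of the scalars in class \<open>w\<close>.\<close>
    have "0 = Poly_Mapping.lookup (coeff (rees_map p) (snd w)) (fst w)" by (simp add: zero)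
    also have "\<dots> = (\<Sum>x\<in>K. if G x = w then c x else 0)"
      unfolding p rees_map_sum image coeff_sum lookup_sum
      by (intro sum.cong) (auto simp: lookup_single when_def prod_eq_iff)
    also have "\<dots> = (\<Sum>x | x \<in> K \<and> G x = w. c x)"
      using K by (simp add: sum.If_cases Int_def)
    finally have "(\<Sum>x | x \<in> K \<and> G x = w. c x) = 0" by simp
    moreover have "(\<Sum>x\<in>A. C x) = Poly_Mapping.single 0 (Poly_Mapping.single 0 (\<Sum>x\<in>A. c x))" for A
      unfolding C_def by (induction A rule: infinite_finite_induct) (simp_all add: single_add)
    ultimately show "(\<Sum>x | x \<in> K \<and> G x = w. C x) = 0" by simp
  next
    fix x y assume xy: "x \<in> K" "y \<in> K" "G x = G y"
    have sub: "set_mset (m (fst x)) \<subseteq> min_gens I" if "x \<in> K" for x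
    proof -
      have "Poly_Mapping.keys (fst x) \<subseteq> min_gens I" using that ring by (auto simp: K_def rees_ring_def)
      then show ?thesis using keys_yexp[of "m (fst x)"] m[of "fst x"] by simp
    qed
    have "conn (min_gens I) (snd x, m (fst x)) (snd y, m (fst y))"
      using assms sub xy unfolding linked_def G_def by auto
    then show "F x - F y \<in> ideal_generated_in (rees_ring I) (rees_quadrics I)"
      unfolding F_def using sub[OF xy(1)] by (intro binomial_generated) simp_all
  qed
qed

lemma generated_subset_rees_ideal:
  "ideal_generated_in (rees_ring I) (rees_quadrics I) \<subseteq> rees_ideal I"
proof
  fix x assume "x \<in> ideal_generated_in (rees_ring I) (rees_quadrics I)"
  then obtain F r where F: "x = (\<Sum>b\<in>F. r b * b)" "F \<subseteq> rees_quadrics I" "\<forall>b\<in>F. r b \<in> rees_ring I"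
    unfolding ideal_generated_in_def by blast
  then have mem: "r b * b \<in> rees_ring I" "rees_map (r b * b) = 0" if "b \<in> F" for b
    using that by (auto simp: rees_quadrics_def rees_ideal_def rees_map_mult intro: rees_ring_mult)
  have "(\<Sum>b\<in>F. r b * b) \<in> rees_ring I"
    using mem(1) by (induction F rule: infinite_finite_induct) (simp_all add: rees_ring_zero rees_ring_add)
  then show "x \<in> rees_ideal I" using F(1) mem(2) by (simp add: rees_ideal_def rees_map_sum)
qed

lemma exchange_property_min_gens: "polymatroidal I \<Longrightarrow> exchange_property (min_gens I)"
  unfolding polymatroidal_def exchange_property_def .

theorem theorem3p6:
  fixes I :: "('x::finite, 'k::field) mpoly set"
  assumes "monomial_ideal I"
    and "(polymatroidal I \<and> strong_exchange I) \<or> (polymatroidal I \<and> transversal I) \<or> ferrers_ideal I"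
  shows "rees_ideal I =
    ideal_generated_in (rees_ring I)
      {p \<in> rees_ideal I. bihomogeneous 0 2 p \<or> bihomogeneous 1 1 p}"
proof -
  have "linked (min_gens I)"
    using assms(2)
  proof (elim disjE conjE)
    assume poly: "polymatroidal I" and strong: "strong_exchange I"
    have "base_orderable (min_gens I)"
    proof (rule base_orderable_strong_exchange)
      show "mdeg a = mdeg b" if "a \<in> min_gens I" "b \<in> min_gens I" for a b
        using poly that unfolding polymatroidal_def by blast
    qed (rule strong[unfolded strong_exchange_def, rule_format])
    then show ?thesis using exchange_property_min_gens[OF poly] by (rule linked_if_base_orderable)
  next
    assume poly: "polymatroidal I" and "transversal I"
    then obtain Vs where "I = ideal.span (monomial ` choice_sums Vs)"
      unfolding transversal_def ideal_product_variables by blast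
    \<comment> \<open>All choices have as degree the number of factors, so they form the minimal
      generating set.\<close>
    then have "min_gens I = choice_sums Vs"
      by (simp add: min_gens_equal_degree[of _ "length Vs"] mdeg_choice_sums)
    then have "base_orderable (min_gens I)" by (simp add: base_orderable_choice_sums)
    then show ?thesis using exchange_property_min_gens[OF poly] by (rule linked_if_base_orderable)
  next
    assume "ferrers_ideal I"
    then obtain E where E: "ferrers_graph UNIV E" "I = edge_ideal E" unfolding ferrers_ideal_def by blast
    have "min_gens I = {edge_gen u v |u v. {u, v} \<in> E}"
      unfolding E(2) edge_ideal_eq by (rule min_gens_equal_degree[of _ 2]) (auto simp: mdeg_edge_gen)
    then show ?thesis using linked_ferrers_graph[OF E(1)] by simp
  qed
  then show ?thesis
    using rees_ideal_subset_generated generated_subset_rees_ideal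
    unfolding rees_quadrics_def by blast
qed

end
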